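(* Let $r>0$. Up to linear isometries of $\mathbb E^4_1$, the surface given by $$x(u,v)=\left(\frac r2(u^2+v^2),\,u,\,v,\,\frac r2(u^2+v^2)-\frac1r\right)$$ is the only (oriented space-like) surface in $\mathbb S^3_1(r^2)\subset\mathbb E^4_1$ with harmonic Gauss map; and, up to linear isometries of $\mathbb E^4_1$, the surface given by $$x(u,v)=\left(\frac1r+\frac r2(u^2+v^2),\,u,\,v,\,\frac r2(u^2+v^2)\right)$$ is the only (oriented space-like) surface in $\mathbb H^3(-r^2)\subset\mathbb E^4_1$ with harmonic Gauss map.
   Context: $\mathbb E^4_1$ is $\mathbb R^4$ with the metric $-dx_1^2+dx_2^2+dx_3^2+dx_4^2$; $\mathbb S^3_1(r^2)=\{x\in\mathbb E^4_1:\langle x,x\rangle=r^{-2}\}$ and $\mathbb H^3(-r^2)=\{x\in\mathbb E^4_1:\langle x,x\rangle=-r^{-2},\ x_1>0\}$. A surface is space-like if every nonzero tangent vector $v$ satisfies $\langle v,v\rangle>0$. The Gauss map of an oriented space-like surface $M\subset\mathbb E^4_1$ is $\nu=e_3\wedge e_4:M\to\bigwedge^2\mathbb E^4_1$, where $\{e_1,e_2,e_3,e_4\}$ is an oriented local orthonormal frame of $\mathbb E^4_1$ along $M$ with $e_1,e_2$ tangent and $e_3,e_4$ normal to $M$; $\bigwedge^2\mathbb E^4_1$ is identified with a pseudo-Euclidean space via $\langle f_1\wedge f_2,g_1\wedge g_2\rangle=\det(\langle f_i,g_j\rangle)$. The Laplacian $\Delta=\sum_{i=1}^2(\nabla_{e_i}e_i-e_ie_i)$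 of $M$ acts componentwise on $\nu$, and $\nu$ is harmonic if $\Delta\nu=0$. The uniqueness is understood locally: every point of a surface with the stated property has an open neighbourhood that is mapped by a linear isometry of $\mathbb E^4_1$ onto an open part of the displayed surface (i.e. with $(u,v)$ ranging over an open subset of $\mathbb R^2$). *)

theory Defs
  imports "HOL-Analysis.Analysis"
begin

section \<open>Smooth maps\<close>

text \<open>Meaningful for open \<open>S\<close> only: the derivatives are two-sided.\<close>

fun Ck_on :: "nat \<Rightarrow> ('a::euclidean_space \<Rightarrow> 'b::real_normed_vector) \<Rightarrow> 'a set \<Rightarrow> bool" where
  "Ck_on 0 f S \<longleftrightarrow> continuous_on S f"
| "Ck_on (Suc k) f S \<longleftrightarrow>
     (\<forall>p\<in>S. f differentiable (at p)) \<and>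
     (\<forall>v. Ck_on k (\<lambda>p. frechet_derivative f (at p) v) S)"

definition smooth_on :: "('a::euclidean_space \<Rightarrow> 'b::real_normed_vector) \<Rightarrow> 'a set \<Rightarrow> bool" where
  "smooth_on f S \<longleftrightarrow> (\<forall>k. Ck_on k f S)"


section \<open>Minkowski space\<close>

definition lorentz :: "real^4 \<Rightarrow> real^4 \<Rightarrow> real" where
  "lorentz x y = - (x$1 * y$1) + x$2 * y$2 + x$3 * y$3 + x$4 * y$4"

definition linear_isometry :: "(real^4 \<Rightarrow> real^4) \<Rightarrow> bool" where
  "linear_isometry L \<longleftrightarrow> linear L \<and> (\<forall>x y. lorentz (L x) (L y) = lorentz x y)"

text \<open>\<open>S31 c\<close> and \<open>H3 c\<close> are indexed by the absolute value \<open>c > 0\<close> of the curvature, so that the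
  de Sitter space and the hyperbolic space of the theorem are \<open>S31 (r\<^sup>2)\<close> and \<open>H3 (r\<^sup>2)\<close>.\<close>

definition S31 :: "real \<Rightarrow> (real^4) set" where
  "S31 c = {x. lorentz x x = 1 / c}"

definition H3 :: "real \<Rightarrow> (real^4) set" where
  "H3 c = {x. lorentz x x = - (1 / c) \<and> x$1 > 0}"

text \<open>Bivectors are skew-symmetric matrices: the entries \<open>(i, j)\<close> with \<open>i < j\<close> of \<open>wedge a b\<close> are
  the coordinates of the bivector in the basis of the \<open>\<epsilon>\<^sub>i \<and> \<epsilon>\<^sub>j\<close>.  Operators that act
  componentwise on bivector-valued maps thus act entrywise.\<close>

definition wedge :: "real^4 \<Rightarrow> real^4 \<Rightarrow> real^4^4" where
  "wedge a b = (\<chi> i j. a$i * b$j - a$j * b$i)"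


section \<open>Oriented space-like surfaces\<close>

text \<open>A chart is given by the inverse parametrization \<open>\<psi>\<close> of a coordinate neighbourhood, defined on
  an open set \<open>U\<close> of the plane.\<close>

type_synonym 'a atlas = "((real^2) set \<times> (real^2 \<Rightarrow> 'a)) set"

definition oriented_surface :: "'a topology \<Rightarrow> 'a atlas \<Rightarrow> bool" where
  "oriented_surface M A \<longleftrightarrow>
     Hausdorff_space M \<and> second_countable M \<and>
     topspace M = (\<Union>(U, \<psi>)\<in>A. \<psi> ` U) \<and>
     (\<forall>(U, \<psi>)\<in>A. open U \<and> openin M (\<psi> ` U) \<and> embedding_map (top_of_set U) M \<psi>) \<and>
     (\<forall>(U, \<psi>)\<in>A. \<forall>(V, \<theta>)\<in>A.
        let W = {p \<in> U. \<psi> p \<in> \<theta> ` V}; \<tau> = inv_into V \<theta> \<circ> \<psi>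
        in smooth_on \<tau> W \<and> (\<forall>p\<in>W. det (jacobian \<tau> (at p)) > 0))"

definition spacelike_immersion :: "'a atlas \<Rightarrow> ('a \<Rightarrow> real^4) \<Rightarrow> bool" where
  "spacelike_immersion A f \<longleftrightarrow>
     (\<forall>(U, \<psi>)\<in>A. smooth_on (f \<circ> \<psi>) U \<and>
        (\<forall>p\<in>U. let df = frechet_derivative (f \<circ> \<psi>) (at p)
               in inj df \<and> (\<forall>w\<in>range df. w \<noteq> 0 \<longrightarrow> lorentz w w > 0)))"

definition spacelike_surface :: "'a topology \<Rightarrow> 'a atlas \<Rightarrow> ('a \<Rightarrow> real^4) \<Rightarrow> bool" where
  "spacelike_surface M A f \<longleftrightarrow> oriented_surface M A \<and> spacelike_immersion A f"


section \<open>The Gauss map\<close>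

definition oriented_tangent_basis ::
    "'a atlas \<Rightarrow> ('a \<Rightarrow> real^4) \<Rightarrow> 'a \<Rightarrow> real^4 \<Rightarrow> real^4 \<Rightarrow> bool" where
  "oriented_tangent_basis A f q X Y \<longleftrightarrow>
     (\<exists>(U, \<psi>)\<in>A. \<exists>p\<in>U. \<exists>a b. \<psi> p = q \<and> det (vector [a, b] :: real^2^2) > 0 \<and>
        X = frechet_derivative (f \<circ> \<psi>) (at p) a \<and> Y = frechet_derivative (f \<circ> \<psi>) (at p) b)"

text \<open>The vectors \<open>e 3\<close>, \<open>e 4\<close> are normal because they are orthogonal to \<open>e 1\<close>, \<open>e 2\<close>, which
  span the tangent plane.\<close>

definition adapted_frame :: "'a atlas \<Rightarrow> ('a \<Rightarrow> real^4) \<Rightarrow> 'a \<Rightarrow> (4 \<Rightarrow> real^4) \<Rightarrow> bool" where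
  "adapted_frame A f q e \<longleftrightarrow>
     (\<forall>i. \<bar>lorentz (e i) (e i)\<bar> = 1) \<and> (\<forall>i j. i \<noteq> j \<longrightarrow> lorentz (e i) (e j) = 0) \<and>
     det (\<chi> i. e i) > 0 \<and> oriented_tangent_basis A f q (e 1) (e 2)"

text \<open>Well defined: two adapted frames at \<open>q\<close> differ on the normal plane by a linear map of
  determinant 1, so \<open>e 3 \<and> e 4\<close> does not depend on the frame, nor on which of \<open>e 3\<close>, \<open>e 4\<close>
  is the time-like one.\<close>

definition gauss_map :: "'a atlas \<Rightarrow> ('a \<Rightarrow> real^4) \<Rightarrow> 'a \<Rightarrow> real^4^4" where
  "gauss_map A f q = (THE w. \<exists>e. adapted_frame A f q e \<and> w = wedge (e 3) (e 4))"


section \<open>The Laplacian\<close>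

text \<open>In this section \<open>x\<close> is the immersion in a chart, and tangent vectors and vector fields are
  written in the coordinates of the chart: \<open>X\<close> stands for \<open>dx(X)\<close>.\<close>

definition vf_deriv ::
    "(real^2 \<Rightarrow> real^2) \<Rightarrow> (real^2 \<Rightarrow> 'b::real_normed_vector) \<Rightarrow> real^2 \<Rightarrow> 'b" where
  "vf_deriv X \<phi> = (\<lambda>p. frechet_derivative \<phi> (at p) (X p))"

text \<open>The Levi-Civita connection of the induced metric: \<open>\<nabla>\<^sub>X Y\<close> is the tangential part of the
  derivative of \<open>dx(Y)\<close> along \<open>X\<close> in the flat ambient space.\<close>

definition levi_civita ::
    "(real^2 \<Rightarrow> real^4) \<Rightarrow> (real^2 \<Rightarrow> real^2) \<Rightarrow> (real^2 \<Rightarrow> real^2) \<Rightarrow> real^2 \<Rightarrow> real^2" where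
  "levi_civita x X Y = (\<lambda>p. THE z. \<forall>w.
     lorentz (frechet_derivative x (at p) z) (frechet_derivative x (at p) w)
     = lorentz (vf_deriv X (vf_deriv Y x) p) (frechet_derivative x (at p) w))"

definition tangent_frame :: "(real^2 \<Rightarrow> real^4) \<Rightarrow> (real^2) set \<Rightarrow> (2 \<Rightarrow> real^2 \<Rightarrow> real^2) \<Rightarrow> bool" where
  "tangent_frame x V E \<longleftrightarrow> open V \<and> (\<forall>i. smooth_on (E i) V) \<and>
     (\<forall>p\<in>V. \<forall>i j. lorentz (vf_deriv (E i) x p) (vf_deriv (E j) x p) = (if i = j then 1 else 0))"

definition laplacian ::
    "(real^2 \<Rightarrow> real^4) \<Rightarrow> (2 \<Rightarrow> real^2 \<Rightarrow> real^2) \<Rightarrow> (real^2 \<Rightarrow> 'b::real_normed_vector) \<Rightarrow> real^2 \<Rightarrow> 'b" where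
  "laplacian x E \<phi> p =
     (\<Sum>i\<in>UNIV. vf_deriv (levi_civita x (E i) (E i)) \<phi> p - vf_deriv (E i) (vf_deriv (E i) \<phi>) p)"

text \<open>The Laplacian does not depend on the frame; harmonicity is required for all local
  orthonormal tangent frames (which exist around every point, by the Gram-Schmidt process).\<close>

definition harmonic_map ::
    "'a atlas \<Rightarrow> ('a \<Rightarrow> real^4) \<Rightarrow> ('a \<Rightarrow> 'b::real_normed_vector) \<Rightarrow> bool" where
  "harmonic_map A f \<nu> \<longleftrightarrow>
     (\<forall>(U, \<psi>)\<in>A. \<forall>V E. V \<subseteq> U \<and> tangent_frame (f \<circ> \<psi>) V E \<longrightarrow>
        (\<forall>p\<in>V. laplacian (f \<circ> \<psi>) E (\<nu> \<circ> \<psi>) p = 0))"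


section \<open>The two surfaces and local uniqueness\<close>

definition surf_S31 :: "real \<Rightarrow> real^2 \<Rightarrow> real^4" where
  "surf_S31 r p = (let u = p$1; v = p$2 in
     vector [r/2 * (u^2 + v^2), u, v, r/2 * (u^2 + v^2) - 1/r])"

definition surf_H3 :: "real \<Rightarrow> real^2 \<Rightarrow> real^4" where
  "surf_H3 r p = (let u = p$1; v = p$2 in
     vector [1/r + r/2 * (u^2 + v^2), u, v, r/2 * (u^2 + v^2)])"

text \<open>The plane as an oriented surface, with the identity as its only chart.\<close>

definition plane_atlas :: "(real^2) atlas" where
  "plane_atlas = {(UNIV, id)}"

definition locally_congruent :: "'a topology \<Rightarrow> ('a \<Rightarrow> real^4) \<Rightarrow> (real^2 \<Rightarrow> real^4) \<Rightarrow> bool" where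
  "locally_congruent M f x \<longleftrightarrow>
     (\<forall>q\<in>topspace M. \<exists>N L W. openin M N \<and> q \<in> N \<and> linear_isometry L \<and> open W \<and>
        L ` f ` N = x ` W)"

end

theory Submission
  imports Defs
begin

text \<open>Put \<open>\<epsilon> = 1\<close> for de Sitter space and \<open>\<epsilon> = -1\<close> for hyperbolic space, so that the surface lies in the
  quadric \<open>\<langle>x, x\<rangle> = \<epsilon> / r\<^sup>2\<close>.  Its normal plane is spanned by \<open>\<xi> = r x\<close> and a unit normal \<open>N\<close> tangent to the
  quadric, and the Gauss map is \<open>\<nu> = \<xi> \<and> N\<close>.  The components of \<open>\<Delta>\<nu>\<close> show that \<open>\<nu>\<close> is harmonic iff the
  shape operator \<open>A\<close> of \<open>N\<close> has constant trace and \<open>|A|\<^sup>2 = 2 r\<^sup>2\<close>.  By the Codazzi and Gauss equations two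
  distinct constant eigenvalues would force \<open>det A = r\<^sup>2\<close>, contradicting \<open>|A|\<^sup>2 = 2 r\<^sup>2\<close>; hence \<open>A\<close> is \<open>r\<close> or
  \<open>-r\<close> times the identity, and \<open>N + h x\<close> (with \<open>h\<close> the eigenvalue) is a constant null vector.  So the surface
  lies in the section of the quadric by a degenerate hyperplane, and linear isometries act transitively on
  nonzero null vectors.\<close>

section \<open>Calculus of smooth maps\<close>

text \<open>One computation serves both quadrics because the normal plane has signature (1,1) in
  either case: \<xi> and N have squares \<epsilon> and -\<epsilon>. In the Codazzi, Gauss and
  harmonicity equations \<epsilon> then appears at most as an overall factor or as \<epsilon> *
  \<epsilon>. The Laplacian collapses because \<xi> is umbilic, its differential being r dx:
  everything in \<Delta>\<nu> that is not a multiple of \<xi> cancels. In the remaining \<xi> \<and>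
  y, the tangential part of y is a divergence of A, which the Codazzi equations turn into the
  gradient of the trace, and its N-component compares |A|^2 with 2 r^2. The delicate step excludes
  distinct eigenvalues. No principal frame or angle function is chosen; the frame stays arbitrary.
  The trace-free part of A is a point on a circle of constant radius, and the Codazzi equations,
  solved for the connection form, give half the angular form of that circle. This form is closed, so
  the metric is flat, and the Gauss equation expresses flatness as
  \<open>det A = r\<^sup>2\<close>.\<close>

lemma Ck_on_cong:
  assumes "open S" "\<And>p. p \<in> S \<Longrightarrow> f p = g p" "Ck_on k f S"
  shows "Ck_on k g S"
  using assms(2,3)
proof (induction k arbitrary: f g)
  case 0
  then show ?case using continuous_on_cong[of S S f g] by simp
next
  case (Suc k)
  have eq: "frechet_derivative f (at p) = frechet_derivative g (at p)"
    and "g differentiable (at p)" if "p \<in> S" for p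
  proof -
    have "(f has_derivative frechet_derivative f (at p)) (at p)"
      using Suc.prems(2) that frechet_derivative_works by auto
    then have "(g has_derivative frechet_derivative f (at p)) (at p)"
      using has_derivative_transform_within_open[OF _ assms(1) that] Suc.prems(1) by blast
    then show "frechet_derivative f (at p) = frechet_derivative g (at p)"
      "g differentiable (at p)"
      using frechet_derivative_at differentiable_def by blast+
  qed
  moreover have "Ck_on k (\<lambda>p. frechet_derivative g (at p) v) S" for v
    using Suc.IH[of "\<lambda>p. frechet_derivative f (at p) v"] Suc.prems(2) eq by simp
  ultimately show ?case by simp
qed

lemma Ck_on_SucD: "Ck_on (Suc k) f S \<Longrightarrow> Ck_on k f S"
proof (induction k arbitrary: f)
  case 0
  then show ?case
    by (auto intro!: continuous_at_imp_continuous_on differentiable_imp_continuous_within)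
qed auto

lemma Ck_on_subset: "T \<subseteq> S \<Longrightarrow> Ck_on k f S \<Longrightarrow> Ck_on k f T"
  by (induction k arbitrary: f) (auto intro: continuous_on_subset)

lemma Ck_on_SucI:
  assumes "open S" "\<And>p. p \<in> S \<Longrightarrow> (f has_derivative f' p) (at p)" "\<And>v. Ck_on k (\<lambda>p. f' p v) S"
  shows "Ck_on (Suc k) f S"
proof -
  have eq: "f' p = frechet_derivative f (at p)" if "p \<in> S" for p
    using assms(2)[OF that] frechet_derivative_at by blast
  have "Ck_on k (\<lambda>p. frechet_derivative f (at p) v) S" for v
    by (rule Ck_on_cong[OF assms(1) _ assms(3)]) (simp add: eq)
  then show ?thesis
    using differentiableI[OF assms(2)] by simp
qed

lemma Ck_on_const: "Ck_on k (\<lambda>p. c) S"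
  by (induction k arbitrary: c) auto

lemma Ck_on_add:
  assumes "open S" "Ck_on k f S" "Ck_on k g S"
  shows "Ck_on k (\<lambda>p. f p + g p) S"
  using assms(2,3)
proof (induction k arbitrary: f g)
  case (Suc k)
  show ?case
  proof (rule Ck_on_SucI[OF assms(1)])
    fix p assume "p \<in> S"
    then show "((\<lambda>p. f p + g p) has_derivative
        (\<lambda>v. frechet_derivative f (at p) v + frechet_derivative g (at p) v)) (at p)"
      using Suc.prems by (auto intro!: has_derivative_add simp flip: frechet_derivative_works)
  qed (use Suc in auto)
qed (auto intro: continuous_on_add)

text \<open>The product rule writes the derivative as a sum of two values of \<open>B\<close> on
  maps that are again of class C^k, so the induction has to run over all pairs f, g at once. This
  covers products, scalar multiples, \<open>lorentz\<close> and \<open>wedge\<close>.\<close>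

lemma Ck_on_bilinear:
  assumes "bounded_bilinear B" "open S" "Ck_on k f S" "Ck_on k g S"
  shows "Ck_on k (\<lambda>p. B (f p) (g p)) S"
  using assms(3,4)
proof (induction k arbitrary: f g)
  case 0
  then show ?case using bounded_bilinear.continuous_on[OF assms(1)] by auto
next
  case (Suc k)
  show ?case
  proof (rule Ck_on_SucI[OF assms(2)])
    fix p assume "p \<in> S"
    then show "((\<lambda>p. B (f p) (g p)) has_derivative
        (\<lambda>v. B (f p) (frechet_derivative g (at p) v) + B (frechet_derivative f (at p) v) (g p))) (at p)"
      using Suc.prems
      by (auto intro!: bounded_bilinear.FDERIV[OF assms(1)] simp flip: frechet_derivative_works)
  next
    fix v
    have "Ck_on k f S" "Ck_on k g S" using Suc.prems by (auto intro: Ck_on_SucD simp del: Ck_on.simps)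
    then show "Ck_on k (\<lambda>p. B (f p) (frechet_derivative g (at p) v) + B (frechet_derivative f (at p) v) (g p)) S"
      using Suc.prems by (intro Ck_on_add[OF assms(2)] Suc.IH) simp_all
  qed
qed

text \<open>For g = 1 / sqrt f the derivative is -(1/2) f' g^3, a polynomial in f' and g itself, so
  the induction closes on this single function. Gram-Schmidt normalization needs exactly this
  function.\<close>

lemma Ck_on_inverse_sqrt:
  fixes f :: "'a::euclidean_space \<Rightarrow> real"
  assumes "open S" "\<And>p. p \<in> S \<Longrightarrow> f p > 0" "Ck_on k f S"
  shows "Ck_on k (\<lambda>p. 1 / sqrt (f p)) S"
  using assms(3)
proof (induction k)
  case 0
  then show ?case using assms(2) by (force intro!: continuous_intros)
next
  case (Suc k)
  let ?g = "\<lambda>p. 1 / sqrt (f p)"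
  show ?case
  proof (rule Ck_on_SucI[OF assms(1)])
    fix p assume p: "p \<in> S"
    have fp: "f p > 0" using assms(2) p .
    have d: "(f has_derivative frechet_derivative f (at p)) (at p)"
      using Suc.prems p by (auto simp flip: frechet_derivative_works)
    have r: "((\<lambda>t. 1 / sqrt t) has_real_derivative - (1 / 2) * (?g p * ?g p * ?g p)) (at (f p))"
      using fp
      by (auto intro!: derivative_eq_intros simp: field_simps power2_eq_square)
    show "(?g has_derivative
        (\<lambda>v. (- (1/2) * frechet_derivative f (at p) v) * (?g p * ?g p * ?g p))) (at p)"
      using has_derivative_compose[OF d r[unfolded has_field_derivative_def]]
      by (simp add: mult.commute mult.left_commute)
  next
    fix v
    have "Ck_on k ?g S" using Suc Ck_on_SucD by blast
    then show "Ck_on k (\<lambda>p. (- (1/2) * frechet_derivative f (at p) v) * (?g p * ?g p * ?g p)) S"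
      using Suc.prems
      by (intro Ck_on_bilinear[OF bounded_bilinear_mult assms(1)] Ck_on_const) auto
  qed
qed

lemma smooth_on_cong: "open S \<Longrightarrow> (\<And>p. p \<in> S \<Longrightarrow> f p = g p) \<Longrightarrow> smooth_on f S \<Longrightarrow> smooth_on g S"
  unfolding smooth_on_def using Ck_on_cong by blast

lemma smooth_on_subset: "smooth_on f S \<Longrightarrow> T \<subseteq> S \<Longrightarrow> smooth_on f T"
  unfolding smooth_on_def using Ck_on_subset by blast

lemma smooth_on_const: "smooth_on (\<lambda>p. c) S"
  by (simp add: smooth_on_def Ck_on_const)

lemma smooth_on_add:
  "open S \<Longrightarrow> smooth_on f S \<Longrightarrow> smooth_on g S \<Longrightarrow> smooth_on (\<lambda>p. f p + g p) S"
  by (simp add: smooth_on_def Ck_on_add)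

lemma smooth_on_bilinear:
  "bounded_bilinear B \<Longrightarrow> open S \<Longrightarrow> smooth_on f S \<Longrightarrow> smooth_on g S \<Longrightarrow> smooth_on (\<lambda>p. B (f p) (g p)) S"
  by (simp add: smooth_on_def Ck_on_bilinear)

lemmas smooth_on_mult = smooth_on_bilinear[OF bounded_bilinear_mult]
  and smooth_on_scaleR = smooth_on_bilinear[OF bounded_bilinear_scaleR]

lemma smooth_on_inverse_sqrt:
  fixes f :: "'a::euclidean_space \<Rightarrow> real"
  shows "open S \<Longrightarrow> (\<And>p. p \<in> S \<Longrightarrow> f p > 0) \<Longrightarrow> smooth_on f S \<Longrightarrow> smooth_on (\<lambda>p. 1 / sqrt (f p)) S"
  by (simp add: smooth_on_def Ck_on_inverse_sqrt)

lemma smooth_on_uminus: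
  fixes f :: "'a::euclidean_space \<Rightarrow> 'b::real_normed_vector"
  shows "open S \<Longrightarrow> smooth_on f S \<Longrightarrow> smooth_on (\<lambda>p. - f p) S"
  using smooth_on_scaleR[OF _ smooth_on_const[of "-1"], of S f] by simp

lemma smooth_on_diff:
  fixes f g :: "'a::euclidean_space \<Rightarrow> 'b::real_normed_vector"
  shows "open S \<Longrightarrow> smooth_on f S \<Longrightarrow> smooth_on g S \<Longrightarrow> smooth_on (\<lambda>p. f p - g p) S"
  using smooth_on_add[OF _ _ smooth_on_uminus, of S f g] by simp

lemma smooth_on_sum:
  "open S \<Longrightarrow> (\<And>i. i \<in> I \<Longrightarrow> smooth_on (f i) S) \<Longrightarrow> smooth_on (\<lambda>p. \<Sum>i\<in>I. f i p) S"
  by (induction I rule: infinite_finite_induct) (auto intro: smooth_on_const smooth_on_add)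

lemma smooth_on_linear:
  assumes "bounded_linear L" "open S" "smooth_on f S"
  shows "smooth_on (\<lambda>p. L (f p)) S"
  using smooth_on_bilinear[OF _ assms(2) smooth_on_const[of "1::real"] assms(3), of "\<lambda>c x. c *\<^sub>R L x"]
    bounded_bilinear.comp[OF bounded_bilinear_scaleR bounded_linear_ident assms(1)] by simp

lemma smooth_on_id: "smooth_on (\<lambda>p. p) S"
  unfolding smooth_on_def
proof
  fix k show "Ck_on k (\<lambda>p. p) S"
    by (cases k) (auto simp: Ck_on_const)
qed

lemma smooth_on_has_derivative:
  "smooth_on f S \<Longrightarrow> p \<in> S \<Longrightarrow> (f has_derivative frechet_derivative f (at p)) (at p)"
  unfolding smooth_on_def by (metis Ck_on.simps(2) frechet_derivative_works)

lemma smooth_on_bounded_linear_deriv: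
  "smooth_on f S \<Longrightarrow> p \<in> S \<Longrightarrow> bounded_linear (frechet_derivative f (at p))"
  using smooth_on_has_derivative has_derivative_bounded_linear by blast

lemma smooth_on_deriv: "smooth_on f S \<Longrightarrow> smooth_on (\<lambda>p. frechet_derivative f (at p) v) S"
  unfolding smooth_on_def using Ck_on.simps(2) by blast

lemma smooth_on_continuous: "smooth_on f S \<Longrightarrow> continuous_on S f"
  unfolding smooth_on_def by (metis Ck_on.simps(1))

text \<open>Base point and direction vary together, while \<open>Ck_on\<close> differentiates in
  fixed directions; expanding X p in the standard basis separates the two.\<close>

lemma smooth_on_vf_deriv:
  assumes "open S" "smooth_on X S" "smooth_on \<phi> S"
  shows "smooth_on (vf_deriv X \<phi>) S"
proof (rule smooth_on_cong[OF assms(1)])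
  show "smooth_on (\<lambda>p. \<Sum>b\<in>Basis. (X p \<bullet> b) *\<^sub>R frechet_derivative \<phi> (at p) b) S"
    using assms
    by (intro smooth_on_sum smooth_on_scaleR smooth_on_deriv
        smooth_on_linear[OF bounded_linear_inner_left])
  fix p assume "p \<in> S"
  then interpret bounded_linear "frechet_derivative \<phi> (at p)"
    using assms(3) smooth_on_bounded_linear_deriv by blast
  show "(\<Sum>b\<in>Basis. (X p \<bullet> b) *\<^sub>R frechet_derivative \<phi> (at p) b) = vf_deriv X \<phi> p"
    unfolding vf_deriv_def by (subst (2) euclidean_representation[of "X p", symmetric])
      (simp add: sum scaleR)
qed

lemma smooth_on_vec_nth:
  fixes f :: "'a::euclidean_space \<Rightarrow> real^'n"
  shows "open S \<Longrightarrow> smooth_on f S \<Longrightarrow> smooth_on (\<lambda>p. f p $ i) S"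
  by (rule smooth_on_linear[OF bounded_linear_vec_nth])

lemma smooth_on_vec_lambda:
  fixes f :: "'a::euclidean_space \<Rightarrow> real^'n"
  assumes "open S" "\<And>i. smooth_on (\<lambda>p. f p $ i) S"
  shows "smooth_on f S"
proof (rule smooth_on_cong[OF assms(1)])
  show "smooth_on (\<lambda>p. \<Sum>i\<in>UNIV. (f p $ i) *\<^sub>R (axis i 1 :: real^'n)) S"
    using assms(2) by (intro smooth_on_sum[OF assms(1)] smooth_on_scaleR[OF assms(1)] smooth_on_const)
  show "(\<Sum>i\<in>UNIV. (f p $ i) *\<^sub>R (axis i 1 :: real^'n)) = f p" for p
    using basis_expansion[of "f p"] by (simp add: scalar_mult_eq_scaleR)
qed

section \<open>Symmetry of second derivatives\<close>

text \<open>The mean value theorem is applied along v and then along w. The left side does not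
  change when v and w trade places, so it can be compared with both mixed derivatives.\<close>

lemma second_difference:
  fixes f :: "'a::euclidean_space \<Rightarrow> real"
  assumes "open S" "smooth_on f S" "cball p (h * (norm v + norm w)) \<subseteq> S" "h > 0"
  shows "\<exists>q\<in>cball p (h * (norm v + norm w)).
     f (p + h *\<^sub>R v + h *\<^sub>R w) - f (p + h *\<^sub>R v) - (f (p + h *\<^sub>R w) - f p)
     = h^2 * frechet_derivative (\<lambda>p. frechet_derivative f (at p) v) (at q) w"
proof -
  have in_ball: "p + s *\<^sub>R v + t *\<^sub>R w \<in> cball p (h * (norm v + norm w))"
    if "0 \<le> s" "s \<le> h" "0 \<le> t" "t \<le> h" for s t
  proof -
    have "norm (s *\<^sub>R v + t *\<^sub>R w) \<le> s * norm v + t * norm w"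
      using norm_triangle_ineq[of "s *\<^sub>R v" "t *\<^sub>R w"] that by simp
    also have "\<dots> \<le> h * (norm v + norm w)"
      using that by (simp add: distrib_left add_mono mult_right_mono)
    finally show ?thesis by (simp add: dist_norm norm_minus_commute algebra_simps)
  qed
  have line: "((\<lambda>s. g (a + s *\<^sub>R u)) has_real_derivative frechet_derivative g (at (a + s *\<^sub>R u)) u) (at s)"
    if "smooth_on g S" "a + s *\<^sub>R u \<in> S" for g :: "'a \<Rightarrow> real" and a u s
  proof -
    interpret bounded_linear "frechet_derivative g (at (a + s *\<^sub>R u))"
      using smooth_on_bounded_linear_deriv[OF that] .
    have "((\<lambda>s. a + s *\<^sub>R u) has_derivative (\<lambda>c. c *\<^sub>R u)) (at s)"
      by (auto intro!: derivative_eq_intros)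
    from has_derivative_compose[OF this smooth_on_has_derivative[OF that]] show ?thesis
      by (simp add: has_field_derivative_def scaleR mult.commute[of _ "frechet_derivative g _ u"])
  qed
  let ?g = "\<lambda>p. frechet_derivative f (at p) v"
  have "\<exists>s>0. s < h \<and> (f (p + h *\<^sub>R w + h *\<^sub>R v) - f (p + h *\<^sub>R v)) - (f (p + h *\<^sub>R w + 0 *\<^sub>R v) - f (p + 0 *\<^sub>R v))
      = (h - 0) * (?g (p + h *\<^sub>R w + s *\<^sub>R v) - ?g (p + s *\<^sub>R v))"
  proof (rule MVT2[OF assms(4)])
    fix s assume "0 \<le> s" "s \<le> h"
    then show "((\<lambda>s. f (p + h *\<^sub>R w + s *\<^sub>R v) - f (p + s *\<^sub>R v)) has_real_derivative
        ?g (p + h *\<^sub>R w + s *\<^sub>R v) - ?g (p + s *\<^sub>R v)) (at s)"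
      using in_ball[of s h] in_ball[of s 0] assms
      by (intro DERIV_diff line) (auto simp: algebra_simps)
  qed
  then obtain s where s: "0 < s" "s < h" "f (p + h *\<^sub>R v + h *\<^sub>R w) - f (p + h *\<^sub>R v) - (f (p + h *\<^sub>R w) - f p)
      = h * (?g (p + s *\<^sub>R v + h *\<^sub>R w) - ?g (p + s *\<^sub>R v + 0 *\<^sub>R w))"
    by (auto simp: add.commute add.left_commute)
  have "\<exists>t>0. t < h \<and> ?g (p + s *\<^sub>R v + h *\<^sub>R w) - ?g (p + s *\<^sub>R v + 0 *\<^sub>R w)
      = (h - 0) * frechet_derivative ?g (at (p + s *\<^sub>R v + t *\<^sub>R w)) w"
  proof (rule MVT2[OF assms(4)])
    fix t assume "0 \<le> t" "t \<le> h"
    then show "((\<lambda>t. ?g (p + s *\<^sub>R v + t *\<^sub>R w)) has_real_derivative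
        frechet_derivative ?g (at (p + s *\<^sub>R v + t *\<^sub>R w)) w) (at t)"
      using in_ball[of s t] s assms by (intro line smooth_on_deriv) auto
  qed
  then obtain t where "0 < t" "t < h" "?g (p + s *\<^sub>R v + h *\<^sub>R w) - ?g (p + s *\<^sub>R v + 0 *\<^sub>R w)
      = h * frechet_derivative ?g (at (p + s *\<^sub>R v + t *\<^sub>R w)) w"
    by auto
  then show ?thesis
    using s in_ball[of s t] by (intro bexI[of _ "p + s *\<^sub>R v + t *\<^sub>R w"]) (auto simp: power2_eq_square)
qed

lemma second_derivative_symmetric_real:
  fixes f :: "'a::euclidean_space \<Rightarrow> real"
  assumes "open S" "smooth_on f S" "p \<in> S"
  shows "frechet_derivative (\<lambda>p. frechet_derivative f (at p) v) (at p) w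
       = frechet_derivative (\<lambda>p. frechet_derivative f (at p) w) (at p) v"
    (is "?F p = ?G p")
proof (rule ccontr)
  assume "?F p \<noteq> ?G p"
  \<comment> \<open>Half the gap: two equal numbers cannot lie strictly within e of
    \<open>?F p\<close> and of \<open>?G p\<close> respectively.\<close>
  define e where "e = \<bar>?F p - ?G p\<bar> / 2"
  have e: "e > 0" using \<open>?F p \<noteq> ?G p\<close> by (simp add: e_def)
  have "continuous_on S ?F" "continuous_on S ?G"
    using assms by (auto intro!: smooth_on_continuous smooth_on_deriv)
  then have "isCont ?F p" "isCont ?G p"
    using assms continuous_on_eq_continuous_at by blast+
  then obtain d1 d2 where d: "d1 > 0" "d2 > 0"
    "\<And>q. dist q p < d1 \<Longrightarrow> dist (?F q) (?F p) < e" "\<And>q. dist q p < d2 \<Longrightarrow> dist (?G q) (?G p) < e"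
    using e unfolding continuous_at_eps_delta by metis
  obtain d3 where d3: "d3 > 0" "ball p d3 \<subseteq> S"
    using assms open_contains_ball by blast
  define R where "R = Min {d1, d2, d3}"
  have R: "R > 0" "R \<le> d1" "R \<le> d2" "R \<le> d3" using d d3 by (auto simp: R_def)
  \<comment> \<open>The summand 1 keeps the denominator positive when v and w both vanish; the
    factor 2 leaves room for a strict inequality.\<close>
  define h where "h = R / (2 * (norm v + norm w + 1))"
  have nn: "norm v + norm w + 1 > 0" by (simp add: add_nonneg_pos)
  have h: "h > 0" using R nn by (simp add: h_def)
  have "h * (norm v + norm w) \<le> h * (norm v + norm w + 1)"
    using h by simp
  also have "\<dots> = R / 2" using nn by (simp add: h_def field_simps)
  finally have hR: "h * (norm v + norm w) < R" using R by simp
  have sub: "cball p (h * (norm v + norm w)) \<subseteq> S"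
    using hR R d3 by (auto simp: subset_iff)
  obtain q where q: "q \<in> cball p (h * (norm v + norm w))"
    "f (p + h *\<^sub>R v + h *\<^sub>R w) - f (p + h *\<^sub>R v) - (f (p + h *\<^sub>R w) - f p) = h^2 * ?F q"
    using second_difference[OF assms(1,2) sub h] by blast
  have sub': "cball p (h * (norm w + norm v)) \<subseteq> S" using sub by (simp add: add.commute)
  obtain q' where q': "q' \<in> cball p (h * (norm v + norm w))"
    "f (p + h *\<^sub>R w + h *\<^sub>R v) - f (p + h *\<^sub>R w) - (f (p + h *\<^sub>R v) - f p) = h^2 * ?G q'"
    using second_difference[OF assms(1,2) sub' h] by (auto simp: add.commute)
  have "f (p + h *\<^sub>R w + h *\<^sub>R v) = f (p + h *\<^sub>R v + h *\<^sub>R w)" by (simp add: add.commute add.left_commute)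
  then have "h^2 * ?F q = h^2 * ?G q'" using q(2) q'(2) by linarith
  then have "?F q = ?G q'" using h by simp
  moreover have "dist (?F q) (?F p) < e" "dist (?G q') (?G p) < e"
    using q(1) q'(1) hR R d(3)[of q] d(4)[of q'] by (auto simp: dist_commute)
  ultimately show False unfolding e_def dist_real_def by argo
qed

lemma second_derivative_symmetric:
  fixes f :: "'a::euclidean_space \<Rightarrow> 'b::euclidean_space"
  assumes "open S" "smooth_on f S" "p \<in> S"
  shows "frechet_derivative (\<lambda>p. frechet_derivative f (at p) v) (at p) w
       = frechet_derivative (\<lambda>p. frechet_derivative f (at p) w) (at p) v"
proof (rule euclidean_eqI)
  fix b :: 'b
  have comp: "frechet_derivative (\<lambda>p. g p \<bullet> b) (at q) u = frechet_derivative g (at q) u \<bullet> b"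
    if "smooth_on g S" "q \<in> S" for g :: "'a \<Rightarrow> 'b" and q u
    using frechet_derivative_at[OF bounded_linear.has_derivative[OF bounded_linear_inner_left
          smooth_on_has_derivative[OF that], of b]] by metis
  have comp2: "frechet_derivative (\<lambda>p. frechet_derivative f (at p) v) (at p) w \<bullet> b
      = frechet_derivative (\<lambda>p. frechet_derivative (\<lambda>p. f p \<bullet> b) (at p) v) (at p) w" for v w
  proof -
    have "frechet_derivative (\<lambda>p. frechet_derivative f (at p) v) (at p) w \<bullet> b
      = frechet_derivative (\<lambda>p. frechet_derivative f (at p) v \<bullet> b) (at p) w"
      using comp[OF smooth_on_deriv[OF assms(2)] assms(3)] by simp
    also have "\<dots> = frechet_derivative (\<lambda>p. frechet_derivative (\<lambda>p. f p \<bullet> b) (at p) v) (at p) w"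
    proof (rule arg_cong[where f="\<lambda>D. D w"], rule frechet_derivative_transform_within_open)
      show "(\<lambda>p. frechet_derivative f (at p) v \<bullet> b) differentiable at p"
        using smooth_on_has_derivative[OF smooth_on_linear[OF bounded_linear_inner_left assms(1)
            smooth_on_deriv[OF assms(2)]] assms(3)] differentiable_def by blast
    qed (use assms comp[OF assms(2)] in auto)
    finally show ?thesis .
  qed
  show "frechet_derivative (\<lambda>p. frechet_derivative f (at p) v) (at p) w \<bullet> b
       = frechet_derivative (\<lambda>p. frechet_derivative f (at p) w) (at p) v \<bullet> b"
    unfolding comp2
    by (rule second_derivative_symmetric_real[OF assms(1) smooth_on_linear[OF bounded_linear_inner_left assms(1,2)] assms(3)])
qed

section \<open>Lorentzian linear algebra\<close>

lemma det_4:
  "det (A::'a::comm_ring_1^4^4) =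
    A$1$1 * (A$2$2 * (A$3$3 * A$4$4 - A$3$4 * A$4$3) - A$2$3 * (A$3$2 * A$4$4 - A$3$4 * A$4$2)
      + A$2$4 * (A$3$2 * A$4$3 - A$3$3 * A$4$2))
  - A$1$2 * (A$2$1 * (A$3$3 * A$4$4 - A$3$4 * A$4$3) - A$2$3 * (A$3$1 * A$4$4 - A$3$4 * A$4$1)
      + A$2$4 * (A$3$1 * A$4$3 - A$3$3 * A$4$1))
  + A$1$3 * (A$2$1 * (A$3$2 * A$4$4 - A$3$4 * A$4$2) - A$2$2 * (A$3$1 * A$4$4 - A$3$4 * A$4$1)
      + A$2$4 * (A$3$1 * A$4$2 - A$3$2 * A$4$1))
  - A$1$4 * (A$2$1 * (A$3$2 * A$4$3 - A$3$3 * A$4$2) - A$2$2 * (A$3$1 * A$4$3 - A$3$3 * A$4$1)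
      + A$2$3 * (A$3$1 * A$4$2 - A$3$2 * A$4$1))"
proof -
  have f1234: "finite {2::4, 3, 4}" "1 \<notin> {2::4, 3, 4}"
    and f234: "finite {3::4, 4}" "2 \<notin> {3::4, 4}"
    and f34: "finite {4::4}" "3 \<notin> {4::4}"
    by auto
  show ?thesis
    unfolding det_def UNIV_4
    unfolding sum_over_permutations_insert[OF f1234]
    unfolding sum_over_permutations_insert[OF f234]
    unfolding sum_over_permutations_insert[OF f34]
    unfolding permutes_sing
    by (simp add: sign_swap_id permutation_swap_id sign_compose sign_id swap_id_eq permutation_compose
        algebra_simps)
qed

lemma vector_4 [simp]:
  "(vector [a, b, c, d] :: 'a::zero^4) $ 1 = a"
  "(vector [a, b, c, d] :: 'a::zero^4) $ 2 = b"
  "(vector [a, b, c, d] :: 'a::zero^4) $ 3 = c"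
  "(vector [a, b, c, d] :: 'a::zero^4) $ 4 = d"
  by (simp_all add: vector_def)

lemma lorentz_commute: "lorentz x y = lorentz y x"
  by (simp add: lorentz_def mult.commute)

lemma bounded_bilinear_lorentz: "bounded_bilinear lorentz"
proof -
  have "bilinear lorentz"
    unfolding bilinear_def by (auto intro!: linearI simp: lorentz_def algebra_simps)
  then show ?thesis by (simp add: bilinear_conv_bounded_bilinear)
qed

lemma bounded_bilinear_wedge: "bounded_bilinear wedge"
proof -
  have "bilinear wedge"
    unfolding bilinear_def by (auto intro!: linearI simp: wedge_def vec_eq_iff algebra_simps)
  then show ?thesis by (simp add: bilinear_conv_bounded_bilinear)
qed

lemmas lorentz_simps =
  bounded_bilinear.add_left[OF bounded_bilinear_lorentz]
  bounded_bilinear.add_right[OF bounded_bilinear_lorentz]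
  bounded_bilinear.diff_left[OF bounded_bilinear_lorentz]
  bounded_bilinear.diff_right[OF bounded_bilinear_lorentz]
  bounded_bilinear.minus_left[OF bounded_bilinear_lorentz]
  bounded_bilinear.minus_right[OF bounded_bilinear_lorentz]
  bounded_bilinear.scaleR_left[OF bounded_bilinear_lorentz]
  bounded_bilinear.scaleR_right[OF bounded_bilinear_lorentz]
  bounded_bilinear.zero_left[OF bounded_bilinear_lorentz]
  bounded_bilinear.zero_right[OF bounded_bilinear_lorentz]

lemmas wedge_simps =
  bounded_bilinear.add_left[OF bounded_bilinear_wedge]
  bounded_bilinear.add_right[OF bounded_bilinear_wedge]
  bounded_bilinear.diff_left[OF bounded_bilinear_wedge]
  bounded_bilinear.diff_right[OF bounded_bilinear_wedge]
  bounded_bilinear.minus_left[OF bounded_bilinear_wedge]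
  bounded_bilinear.minus_right[OF bounded_bilinear_wedge]
  bounded_bilinear.scaleR_left[OF bounded_bilinear_wedge]
  bounded_bilinear.scaleR_right[OF bounded_bilinear_wedge]

lemma wedge_self [simp]: "wedge a a = 0"
  by (simp add: wedge_def vec_eq_iff)

lemma wedge_swap: "wedge a b = - wedge b a"
  by (simp add: wedge_def vec_eq_iff)

text \<open>Contracting the bivector with a gives <a,a> b = <a,b> a, and a non-null a allows
  division.\<close>

lemma wedge_eq_0:
  assumes "wedge a b = 0" "lorentz a a \<noteq> 0"
  shows "b = (lorentz a b / lorentz a a) *\<^sub>R a"
proof -
  have ab: "a$i * b$j = a$j * b$i" for i j
    using assms(1) by (simp add: wedge_def vec_eq_iff)
  have "lorentz a a * b$j = lorentz a b * a$j" for j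
  proof -
    have "lorentz a a * b$j = - (a$1 * (a$1 * b$j)) + a$2 * (a$2 * b$j) + a$3 * (a$3 * b$j) + a$4 * (a$4 * b$j)"
      by (simp add: lorentz_def algebra_simps)
    also have "\<dots> = lorentz a b * a$j"
      unfolding ab[of _ j] by (simp add: lorentz_def algebra_simps)
    finally show ?thesis .
  qed
  then show ?thesis
    using assms(2) by (simp add: vec_eq_iff field_simps)
qed

section \<open>Gram determinants and orthonormal frames\<close>

definition minkowski_matrix :: "real^4^4" where
  "minkowski_matrix = (\<chi> i j. if i = j then (if i = 1 then -1 else 1) else 0)"

text \<open>The Gram matrix factors through the matrix of the metric, whose determinant -1 is the
  source of the sign.\<close>

lemma det_gram:
  "det (\<chi> i. a i) * det (\<chi> i. b i) = - det ((\<chi> i j. lorentz (a i) (b j)) :: real^4^4)"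
proof -
  have "(\<chi> i j. lorentz (a i) (b j)) = (\<chi> i. a i) ** minkowski_matrix ** transpose (\<chi> i. b i)"
    by (simp add: vec_eq_iff matrix_matrix_mult_def transpose_def minkowski_matrix_def lorentz_def
        sum_4 if_distrib forall_4)
  moreover have "det minkowski_matrix = -1"
    by (simp add: det_4 minkowski_matrix_def)
  ultimately show ?thesis by (simp add: det_mul det_transpose)
qed

text \<open>Which vector is time-like is left open: \<xi> and N trade this role between the two
  quadrics.\<close>

definition orthonormal_frame :: "(4 \<Rightarrow> real^4) \<Rightarrow> bool" where
  "orthonormal_frame e \<longleftrightarrow>
     (\<forall>i. \<bar>lorentz (e i) (e i)\<bar> = 1) \<and> (\<forall>i j. i \<noteq> j \<longrightarrow> lorentz (e i) (e j) = 0)"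

text \<open>The Gram matrix is diagonal with entries 1 or -1, so the square of the determinant is
  minus their product; being positive, it must be 1.\<close>

lemma orthonormal_frame_det:
  assumes "orthonormal_frame e" "det (\<chi> i. e i) > 0"
  shows "det (\<chi> i. e i) = 1"
    "lorentz (e 1) (e 1) * lorentz (e 2) (e 2) * lorentz (e 3) (e 3) * lorentz (e 4) (e 4) = -1"
proof -
  define d where "d = det (\<chi> i. e i)"
  define s where "s = lorentz (e 1) (e 1) * lorentz (e 2) (e 2) * lorentz (e 3) (e 3) * lorentz (e 4) (e 4)"
  have "d * d = - s"
    using assms(1) unfolding d_def s_def det_gram by (simp add: det_4 orthonormal_frame_def)
  moreover have "\<bar>s\<bar> = 1"
    using assms(1) by (simp add: s_def abs_mult orthonormal_frame_def)
  moreover have "d * d > 0" using assms(2) by (simp add: d_def)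
  ultimately have s: "s = -1" and "d * d = 1" by linarith+
  then show "det (\<chi> i. e i) = 1"
    using assms(2) by (auto simp: d_def square_eq_1_iff)
  show "lorentz (e 1) (e 1) * lorentz (e 2) (e 2) * lorentz (e 3) (e 3) * lorentz (e 4) (e 4) = -1"
    using s by (simp add: s_def)
qed

text \<open>\<open>B\<close> is chosen so that \<open>P ** B\<close> is the Gram matrix with its
  columns multiplied by the signs, hence the identity. A one-sided inverse of a square matrix is
  two-sided, and \<open>B ** P = mat 1\<close> read entrywise is the expansion.\<close>

lemma orthonormal_frame_expansion:
  assumes "orthonormal_frame e"
  shows "u = (\<Sum>k\<in>UNIV. (lorentz (e k) (e k) * lorentz u (e k)) *\<^sub>R e k)"
proof -
  define P :: "real^4^4" where "P = (\<chi> i. e i)"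
  define B :: "real^4^4" where
    "B = (\<chi> j k. (if j = 1 then -1 else 1) * (e k $ j * lorentz (e k) (e k)))"
  have "lorentz (e i) (e k) * lorentz (e k) (e k) = (if i = k then 1 else 0)" for i k
    using assms abs_mult_self_eq[of "lorentz (e k) (e k)"] unfolding orthonormal_frame_def by auto
  moreover have "(P ** B) $ i $ k = lorentz (e i) (e k) * lorentz (e k) (e k)" for i k
    by (simp add: P_def B_def matrix_matrix_mult_def sum_4 lorentz_def algebra_simps)
  ultimately have "P ** B = mat 1"
    by (simp add: vec_eq_iff mat_def)
  then have "B ** P = mat 1"
    using matrix_left_right_inverse by blast
  then have BP: "(\<Sum>k\<in>UNIV. B $ j $ k * P $ k $ l) = (if j = l then 1 else 0)" for j l
    by (simp add: matrix_matrix_mult_def vec_eq_iff mat_def)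
  have "u $ l = (\<Sum>k\<in>UNIV. (lorentz (e k) (e k) * lorentz u (e k)) * e k $ l)" for l
  proof -
    have "(\<Sum>k\<in>UNIV. (lorentz (e k) (e k) * lorentz u (e k)) * e k $ l)
        = (\<Sum>k\<in>UNIV. \<Sum>j\<in>UNIV. u $ j * (B $ j $ k * P $ k $ l))"
      by (rule sum.cong) (simp_all add: B_def P_def lorentz_def sum_4 algebra_simps)
    also have "\<dots> = (\<Sum>j\<in>UNIV. u $ j * (\<Sum>k\<in>UNIV. B $ j $ k * P $ k $ l))"
      by (subst sum.swap) (simp add: sum_distrib_left)
    also have "\<dots> = u $ l"
      by (simp add: BP if_distrib cong: if_cong)
    finally show ?thesis by simp
  qed
  then show ?thesis by (simp add: vec_eq_iff)
qed

text \<open>Both frames have determinant 1 and their tangential parts differ by a rotation, so the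
  normal parts differ by a map of determinant 1. In terms of the mixed Lorentz products its
  determinant is (s3 s4)(b33 b44 - b34 b43), where both factors are -1.\<close>

lemma wedge_complement_unique:
  assumes e: "orthonormal_frame e" "det (\<chi> i. e i) > 0"
    and e': "orthonormal_frame e'" "det (\<chi> i. e' i) > 0"
    and space: "lorentz (e 1) (e 1) = 1" "lorentz (e 2) (e 2) = 1"
      "lorentz (e' 1) (e' 1) = 1" "lorentz (e' 2) (e' 2) = 1"
    and change: "e' 1 = a *\<^sub>R e 1 + b *\<^sub>R e 2" "e' 2 = c *\<^sub>R e 1 + d *\<^sub>R e 2" "a * d - b * c > 0"
  shows "wedge (e' 3) (e' 4) = wedge (e 3) (e 4)"
proof -
  have o: "lorentz (e i) (e j) = 0" "lorentz (e' i) (e' j) = 0" if "i \<noteq> j" for i j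
    using e e' that by (auto simp: orthonormal_frame_def)
  have ab: "a * a + b * b = 1" "c * c + d * d = 1" "a * c + b * d = 0"
    using space o[of 1 2] o(1)[of 2 1] by (simp_all add: change lorentz_simps mult.commute)
  have "(a * d - b * c) * (a * d - b * c) = (a * a + b * b) * (c * c + d * d) - (a * c + b * d) * (a * c + b * d)"
    by algebra
  then have "(a * d - b * c) * (a * d - b * c) = 1" by (simp add: ab)
  then have det1: "a * d - b * c = 1"
    using change(3) square_eq_1_iff by fastforce
  have "d *\<^sub>R e' 1 - b *\<^sub>R e' 2 = (a * d - b * c) *\<^sub>R e 1"
    "a *\<^sub>R e' 2 - c *\<^sub>R e' 1 = (a * d - b * c) *\<^sub>R e 2"
    by (simp_all add: change algebra_simps)
  then have e12: "e 1 = d *\<^sub>R e' 1 - b *\<^sub>R e' 2" "e 2 = a *\<^sub>R e' 2 - c *\<^sub>R e' 1"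
    by (simp_all add: det1)
  have z1: "lorentz (e' i) (e 1) = 0" "lorentz (e' i) (e 2) = 0" if "i \<in> {3, 4}" for i
    unfolding e12 using that o(2)[of i 1] o(2)[of i 2] by (auto simp: lorentz_simps)
  have z2: "lorentz (e' 1) (e i) = 0" "lorentz (e' 2) (e i) = 0" if "i \<in> {3, 4}" for i
    unfolding change(1,2) using that o(1)[of 1 i] o(1)[of 2 i] by (auto simp: lorentz_simps)
  have z3: "lorentz (e' 1) (e 1) = a" "lorentz (e' 1) (e 2) = b"
    "lorentz (e' 2) (e 1) = c" "lorentz (e' 2) (e 2) = d"
    unfolding change(1,2) using space o(1)[of 1 2] o(1)[of 2 1] by (simp_all add: lorentz_simps)
  define s3 s4 where "s3 = lorentz (e 3) (e 3)" and "s4 = lorentz (e 4) (e 4)"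
  have s34: "s3 * s4 = -1"
    using orthonormal_frame_det(2)[OF e] space by (simp add: s3_def s4_def)
  define b33 b34 b43 b44 where "b33 = lorentz (e' 3) (e 3)" and "b34 = lorentz (e' 3) (e 4)"
    and "b43 = lorentz (e' 4) (e 3)" and "b44 = lorentz (e' 4) (e 4)"
  have "det (\<chi> i. e' i) * det (\<chi> i. e i) = - det ((\<chi> i j. lorentz (e' i) (e j)) :: real^4^4)"
    by (rule det_gram)
  also have "\<dots> = - ((a * d - b * c) * (b33 * b44 - b34 * b43))"
    by (simp add: det_4 b33_def b34_def b43_def b44_def z1 z2 z3 algebra_simps)
  finally have bdet: "b33 * b44 - b34 * b43 = -1"
    using orthonormal_frame_det(1)[OF e] orthonormal_frame_det(1)[OF e'] det1 by simp
  have "e' 3 = (s3 * b33) *\<^sub>R e 3 + (s4 * b34) *\<^sub>R e 4" "e' 4 = (s3 * b43) *\<^sub>R e 3 + (s4 * b44) *\<^sub>R e 4"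
    using orthonormal_frame_expansion[OF e(1), of "e' 3"] orthonormal_frame_expansion[OF e(1), of "e' 4"]
    by (simp_all add: z1 sum_4 s3_def s4_def b33_def b34_def b43_def b44_def)
  then have "wedge (e' 3) (e' 4) = ((s3 * s4) * (b33 * b44 - b34 * b43)) *\<^sub>R wedge (e 3) (e 4)"
    using wedge_swap[of "e 4" "e 3"] by (simp add: wedge_simps algebra_simps)
  then show ?thesis by (simp add: s34 bdet)
qed

section \<open>The triple product and the null cone\<close>

text \<open>The Lorentzian triple vector product: the vector that represents the functional w
  \<mapsto> det (a, b, c, w). The sign of the first coordinate comes from raising the index. Its
  entries are polynomial, so a unit normal built from it is smooth.\<close>

definition lcross :: "real^4 \<Rightarrow> real^4 \<Rightarrow> real^4 \<Rightarrow> real^4" where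
  "lcross a b c = (\<chi> j. (if j = 1 then -1 else 1) * det (vector [a, b, c, axis j 1] :: real^4^4))"

lemma lorentz_lcross: "lorentz (lcross a b c) w = det (vector [a, b, c, w] :: real^4^4)"
  by (simp add: lcross_def lorentz_def det_4 axis_def algebra_simps)

lemma lcross_orthogonal:
  "lorentz (lcross a b c) a = 0" "lorentz (lcross a b c) b = 0" "lorentz (lcross a b c) c = 0"
  unfolding lorentz_lcross by (simp_all add: det_4 algebra_simps)

text \<open>The left side is minus the Gram determinant of a, b, c, which is <c,c> under these
  assumptions.\<close>

lemma lorentz_lcross_lcross:
  assumes "lorentz a a = 1" "lorentz b b = 1" "lorentz a b = 0" "lorentz a c = 0" "lorentz b c = 0"
  shows "lorentz (lcross a b c) (lcross a b c) = - lorentz c c"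
proof -
  have "lorentz (lcross a b c) (lcross a b c) =
    - (lorentz a a * (lorentz b b * lorentz c c - lorentz b c * lorentz b c)
       - lorentz a b * (lorentz a b * lorentz c c - lorentz b c * lorentz a c)
       + lorentz a c * (lorentz a b * lorentz b c - lorentz b b * lorentz a c))"
    unfolding lorentz_lcross unfolding lcross_def
    by (simp add: det_4 axis_def lorentz_def algebra_simps)
  then show ?thesis using assms by simp
qed

lemma smooth_on_lcross:
  fixes a b c :: "'a::euclidean_space \<Rightarrow> real^4"
  assumes "open S" "smooth_on a S" "smooth_on b S" "smooth_on c S"
  shows "smooth_on (\<lambda>p. lcross (a p) (b p) (c p)) S"
proof (rule smooth_on_vec_lambda[OF assms(1)])
  have "\<forall>i. smooth_on (\<lambda>p. lcross (a p) (b p) (c p) $ i) S"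
    using assms unfolding forall_4 lcross_def det_4
    by (intro conjI; simp add: axis_def;
        intro smooth_on_mult smooth_on_add smooth_on_diff smooth_on_uminus smooth_on_vec_nth)
  then show "smooth_on (\<lambda>p. lcross (a p) (b p) (c p) $ i) S" for i ..
qed

text \<open>\<open>R w\<close> is the reflection in the hyperplane orthogonal to w. For null k and l
  the vector k - l has square -2 <k,l>, so if this is nonzero, the reflection in k - l takes k to l.
  Orthogonal null vectors need a detour through a third one.\<close>

lemma null_vector_transitive:
  assumes "lorentz k k = 0" "k \<noteq> 0" "lorentz l l = 0" "l \<noteq> 0"
  obtains L where "linear_isometry L" "L k = l"
proof -
  define R where "R = (\<lambda>w v. v - (2 * lorentz v w / lorentz w w) *\<^sub>R w)"
  have R: "linear_isometry (R w)" if "lorentz w w \<noteq> 0" for w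
    unfolding linear_isometry_def
  proof (intro conjI allI)
    show "linear (R w)"
      by (rule linearI) (simp_all add: R_def lorentz_simps add_divide_distrib algebra_simps)
    show "lorentz (R w x) (R w y) = lorentz x y" for x y
      using that by (simp add: R_def lorentz_simps lorentz_commute field_simps)
  qed
  have R_swap: "R (k - l) k = l" if "lorentz k k = 0" "lorentz l l = 0" "lorentz k l \<noteq> 0" for k l
    using that by (simp add: R_def lorentz_simps lorentz_commute[of l k])
  have nz: "v $ 1 \<noteq> 0" if "lorentz v v = 0" "v \<noteq> 0" for v
  proof
    assume "v $ 1 = 0"
    then have "v$2 * v$2 + v$3 * v$3 + v$4 * v$4 = 0" using that by (simp add: lorentz_def)
    moreover have "v$2 * v$2 \<ge> 0" "v$3 * v$3 \<ge> 0" "v$4 * v$4 \<ge> 0" by auto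
    ultimately have "v$2 * v$2 = 0" "v$3 * v$3 = 0" "v$4 * v$4 = 0" by linarith+
    then show False using that \<open>v $ 1 = 0\<close> by (simp add: vec_eq_iff forall_4)
  qed
  \<comment> \<open>The time reversal of l. It is not orthogonal to l, and not to k either once k is
    orthogonal to l, since a nonzero null vector has a nonzero first coordinate.\<close>
  define m where "m = (vector [- l$1, l$2, l$3, l$4] :: real^4)"
  have m: "lorentz m m = 0" using assms by (simp add: m_def lorentz_def)
  have "lorentz m l = 2 * (l$1 * l$1)" using assms by (simp add: m_def lorentz_def)
  then have ml: "lorentz m l \<noteq> 0" using nz[of l] assms by simp
  show thesis
  proof (cases "lorentz k l = 0")
    case False
    have "linear_isometry (R (k - l))"
      using False assms by (intro R) (simp add: lorentz_simps lorentz_commute[of l k])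
    then show thesis using that R_swap[of k l] False assms by blast
  next
    case True
    have "lorentz k m - lorentz k l = 2 * (k$1 * l$1)" by (simp add: m_def lorentz_def)
    then have km: "lorentz k m \<noteq> 0" using True nz[of l] nz[of k] assms by simp
    have "linear_isometry (R (k - m))" "linear_isometry (R (m - l))"
      using km ml m assms by (intro R; simp add: lorentz_simps lorentz_commute[of m k] lorentz_commute[of l m])+
    then have "linear_isometry (R (m - l) \<circ> R (k - m))"
      by (auto simp: linear_isometry_def linear_compose)
    moreover have "(R (m - l) \<circ> R (k - m)) k = l"
      using R_swap[of k m] R_swap[of m l] km ml m assms by simp
    ultimately show thesis using that by blast
  qed
qed

section \<open>The Gauss map in a chart\<close>

lemma plane_basis:
  fixes a b v :: "real^2"
  assumes "det (vector [a, b] :: real^2^2) \<noteq> 0"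
  obtains s t where "v = s *\<^sub>R a + t *\<^sub>R b"
proof -
  define d where "d = a$1 * b$2 - a$2 * b$1"
  have d: "d \<noteq> 0" using assms by (simp add: det_2 d_def)
  have "d *\<^sub>R v = (v$1 * b$2 - v$2 * b$1) *\<^sub>R a + (a$1 * v$2 - a$2 * v$1) *\<^sub>R b"
    by (simp add: vec_eq_iff forall_2 d_def algebra_simps)
  then have "(1 / d) *\<^sub>R (d *\<^sub>R v) =
      (1 / d) *\<^sub>R ((v$1 * b$2 - v$2 * b$1) *\<^sub>R a + (a$1 * v$2 - a$2 * v$1) *\<^sub>R b)"
    by simp
  then have "v = ((v$1 * b$2 - v$2 * b$1) / d) *\<^sub>R a + ((a$1 * v$2 - a$2 * v$1) / d) *\<^sub>R b"
    using d by (simp add: scaleR_add_right)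
  then show thesis by (rule that)
qed

text \<open>\<open>oriented_tangent_basis\<close> may be witnessed in any chart around the point.
  The chain rule along the transition map, whose Jacobian is positive, carries the witness over to
  the prescribed chart.\<close>

lemma oriented_tangent_basis_chart:
  assumes surf: "spacelike_surface M A f" and chart: "(U, \<psi>) \<in> A" "p \<in> U"
    and otb: "oriented_tangent_basis A f (\<psi> p) X Y"
  obtains a b where "det (vector [a, b] :: real^2^2) > 0"
    "X = frechet_derivative (f \<circ> \<psi>) (at p) a" "Y = frechet_derivative (f \<circ> \<psi>) (at p) b"
proof -
  obtain V \<theta> p' a b where V: "(V, \<theta>) \<in> A" "p' \<in> V" "\<theta> p' = \<psi> p"
    and ab: "det (vector [a, b] :: real^2^2) > 0"
    and XY: "X = frechet_derivative (f \<circ> \<theta>) (at p') a" "Y = frechet_derivative (f \<circ> \<theta>) (at p') b"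
    using otb unfolding oriented_tangent_basis_def by blast
  have os: "oriented_surface M A" and im: "spacelike_immersion A f"
    using surf by (auto simp: spacelike_surface_def)
  have U: "open U" "openin M (\<psi> ` U)" "embedding_map (top_of_set U) M \<psi>"
    and V': "open V" "embedding_map (top_of_set V) M \<theta>"
    using os chart V(1) unfolding oriented_surface_def by blast+
  have inj: "inj_on \<psi> U"
    using U(3) by (auto simp: embedding_map_def homeomorphic_eq_everything_map)
  define W where "W = {q \<in> V. \<theta> q \<in> \<psi> ` U}"
  define \<tau> where "\<tau> = inv_into U \<psi> \<circ> \<theta>"
  have tau: "smooth_on \<tau> W" "\<And>q. q \<in> W \<Longrightarrow> det (jacobian \<tau> (at q)) > 0"
    using os chart V(1) unfolding oriented_surface_def W_def \<tau>_def Let_def by blast+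
  have "continuous_map (top_of_set V) M \<theta>"
    using V'(2) by (auto simp: embedding_map_def homeomorphic_eq_everything_map continuous_map_in_subtopology)
  from openin_continuous_map_preimage[OF this U(2)] have "openin (top_of_set V) W"
    by (simp add: W_def)
  then have W: "open W" using V'(1) openin_open_trans by blast
  have pW: "p' \<in> W" using V chart by (simp add: W_def)
  have "\<tau> p' = p" using V chart inj by (simp add: \<tau>_def)
  have "smooth_on (f \<circ> \<psi>) U" using im chart unfolding spacelike_immersion_def by blast
  then have "((f \<circ> \<psi>) has_derivative frechet_derivative (f \<circ> \<psi>) (at p)) (at (\<tau> p'))"
    using smooth_on_has_derivative chart(2) \<open>\<tau> p' = p\<close> by metis
  from has_derivative_compose[OF smooth_on_has_derivative[OF tau(1) pW] this]
  have "((\<lambda>q. (f \<circ> \<psi>) (\<tau> q)) has_derivative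
      (\<lambda>v. frechet_derivative (f \<circ> \<psi>) (at p) (frechet_derivative \<tau> (at p') v))) (at p')" .
  then have "((f \<circ> \<theta>) has_derivative
      (\<lambda>v. frechet_derivative (f \<circ> \<psi>) (at p) (frechet_derivative \<tau> (at p') v))) (at p')"
    by (rule has_derivative_transform_within_open[OF _ W pW])
      (auto simp: W_def \<tau>_def inv_into_into f_inv_into_f)
  then have fd: "frechet_derivative (f \<circ> \<theta>) (at p') =
      (\<lambda>v. frechet_derivative (f \<circ> \<psi>) (at p) (frechet_derivative \<tau> (at p') v))"
    by (simp flip: frechet_derivative_at)
  define J where "J = jacobian \<tau> (at p')"
  have "linear (frechet_derivative \<tau> (at p'))"
    using smooth_on_bounded_linear_deriv[OF tau(1) pW] bounded_linear.linear by blast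
  then have J: "frechet_derivative \<tau> (at p') v = J *v v" for v
    by (simp add: J_def jacobian_def matrix_works)
  have "det (vector [J *v a, J *v b] :: real^2^2) = det J * det (vector [a, b] :: real^2^2)"
    by (simp add: det_2 matrix_vector_mult_def sum_2 algebra_simps)
  then have "det (vector [J *v a, J *v b] :: real^2^2) > 0"
    using tau(2)[OF pW] ab by (simp add: J_def)
  then show thesis using that XY by (simp add: fd J)
qed

text \<open>Resolves the description operator in \<open>gauss_map\<close>: one adapted frame in one
  chart is enough to compute the value.\<close>

lemma gauss_map_eq:
  assumes surf: "spacelike_surface M A f" and chart: "(U, \<psi>) \<in> A" "p \<in> U"
    and ab: "det (vector [a, b] :: real^2^2) > 0"
    and e: "orthonormal_frame e" "det (\<chi> i. e i) > 0"
      "e 1 = frechet_derivative (f \<circ> \<psi>) (at p) a" "e 2 = frechet_derivative (f \<circ> \<psi>) (at p) b"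
  shows "gauss_map A f (\<psi> p) = wedge (e 3) (e 4)"
proof -
  define df where "df = frechet_derivative (f \<circ> \<psi>) (at p)"
  have im: "spacelike_immersion A f"
    using surf by (auto simp: spacelike_surface_def)
  have sm: "smooth_on (f \<circ> \<psi>) U" and pos: "\<And>w. w \<in> range df \<Longrightarrow> w \<noteq> 0 \<Longrightarrow> lorentz w w > 0"
    using im chart unfolding spacelike_immersion_def df_def Let_def by blast+
  interpret df: bounded_linear df
    unfolding df_def using smooth_on_bounded_linear_deriv[OF sm chart(2)] .
  \<comment> \<open>Tangent vectors are space-like, so of the two squares 1 and -1 allowed by
    \<open>orthonormal_frame\<close> only 1 remains.\<close>
  have unit: "lorentz (e' i) (e' i) = 1" if "orthonormal_frame e'" "e' i \<in> range df" for e' and i :: 4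
    using that pos[of "e' i"] unfolding orthonormal_frame_def
    by (metis abs_of_pos lorentz_simps(9) abs_zero zero_neq_one)
  have adapted: "adapted_frame A f (\<psi> p) e"
    using e ab chart unfolding adapted_frame_def orthonormal_frame_def oriented_tangent_basis_def
    by blast
  have "wedge (e' 3) (e' 4) = wedge (e 3) (e 4)" if "adapted_frame A f (\<psi> p) e'" for e'
  proof -
    have e': "orthonormal_frame e'" "det (\<chi> i. e' i) > 0"
      and otb: "oriented_tangent_basis A f (\<psi> p) (e' 1) (e' 2)"
      using that by (auto simp: adapted_frame_def orthonormal_frame_def)
    obtain a' b' where ab': "det (vector [a', b'] :: real^2^2) > 0" "e' 1 = df a'" "e' 2 = df b'"
      using oriented_tangent_basis_chart[OF surf chart otb] unfolding df_def by blast
    define d where "d = a$1 * b$2 - a$2 * b$1"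
    have d: "d > 0" using ab by (simp add: det_2 d_def)
    obtain s t s' t' where st: "a' = s *\<^sub>R a + t *\<^sub>R b" "b' = s' *\<^sub>R a + t' *\<^sub>R b"
      using plane_basis ab by (metis less_irrefl)
    have "det (vector [a', b'] :: real^2^2) = (s * t' - t * s') * d"
      by (simp add: det_2 st d_def algebra_simps)
    then have "s * t' - t * s' > 0" using ab'(1) d by (simp add: zero_less_mult_iff)
    moreover have "e' 1 = s *\<^sub>R e 1 + t *\<^sub>R e 2" "e' 2 = s' *\<^sub>R e 1 + t' *\<^sub>R e 2"
      using ab' e(3,4) by (simp_all add: st df.add df.scaleR flip: df_def)
    moreover have "e 1 \<in> range df" "e 2 \<in> range df" "e' 1 \<in> range df" "e' 2 \<in> range df"
      using ab' e(3,4) by (simp_all flip: df_def)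
    ultimately show ?thesis
      using wedge_complement_unique[OF e(1,2) e'] unit e(1) e'(1) by blast
  qed
  then show ?thesis
    unfolding gauss_map_def using adapted by (intro the_equality) blast+
qed

text \<open>The factor -\<epsilon> fixes the orientation: the determinant of the frame is
  -\<epsilon> times the square of the triple product, which is itself -\<epsilon>.\<close>

lemma gauss_map_quadric:
  fixes a b :: "real^2"
  assumes surf: "spacelike_surface M A f" and chart: "(U, \<psi>) \<in> A" "p \<in> U"
    and ab: "det (vector [a, b] :: real^2^2) > 0"
    and e12: "e1 = frechet_derivative (f \<circ> \<psi>) (at p) a" "e2 = frechet_derivative (f \<circ> \<psi>) (at p) b"
    and on: "lorentz e1 e1 = 1" "lorentz e2 e2 = 1" "lorentz e1 e2 = 0" "lorentz e1 \<xi> = 0" "lorentz e2 \<xi> = 0"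
    and \<epsilon>: "\<epsilon> = 1 \<or> \<epsilon> = -1" "lorentz \<xi> \<xi> = \<epsilon>"
  shows "gauss_map A f (\<psi> p) = wedge \<xi> (- \<epsilon> *\<^sub>R lcross e1 e2 \<xi>)"
proof -
  define N where "N = - \<epsilon> *\<^sub>R lcross e1 e2 \<xi>"
  define e :: "4 \<Rightarrow> real^4" where
    "e = (\<lambda>i. if i = 1 then e1 else if i = 2 then e2 else if i = 3 then \<xi> else N)"
  have e: "e 1 = e1" "e 2 = e2" "e 3 = \<xi>" "e 4 = N" by (simp_all add: e_def)
  have N: "lorentz e1 N = 0" "lorentz e2 N = 0" "lorentz \<xi> N = 0" "lorentz N N = - \<epsilon>"
    using \<epsilon> lcross_orthogonal[of e1 e2 \<xi>] lorentz_lcross_lcross[OF on(1-5)]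
    by (auto simp: N_def lorentz_simps lorentz_commute)
  have "orthonormal_frame e"
    unfolding orthonormal_frame_def forall_4 e
    using N on \<epsilon> by (auto simp: lorentz_commute)
  moreover have "det (\<chi> i. e i) = 1"
  proof -
    have "det (\<chi> i. e i) = det (vector [e1, e2, \<xi>, N] :: real^4^4)"
      by (simp add: det_4 e)
    also have "\<dots> = - \<epsilon> * lorentz (lcross e1 e2 \<xi>) (lcross e1 e2 \<xi>)"
      by (simp add: N_def lorentz_simps flip: lorentz_lcross)
    also have "\<dots> = 1" using lorentz_lcross_lcross[OF on(1-5)] \<epsilon> by auto
    finally show ?thesis .
  qed
  ultimately show ?thesis
    using gauss_map_eq[OF surf chart ab, of e] e e12 by (simp add: N_def)
qed

section \<open>Differentiation along vector fields\<close>

lemma vf_deriv_eqI: "(\<phi> has_derivative D) (at p) \<Longrightarrow> vf_deriv X \<phi> p = D (X p)"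
  unfolding vf_deriv_def by (simp flip: frechet_derivative_at)

lemma vf_deriv_bilinear:
  assumes "bounded_bilinear B" "smooth_on \<phi> V" "smooth_on \<eta> V" "p \<in> V"
  shows "vf_deriv X (\<lambda>q. B (\<phi> q) (\<eta> q)) p = B (vf_deriv X \<phi> p) (\<eta> p) + B (\<phi> p) (vf_deriv X \<eta> p)"
  using vf_deriv_eqI[OF bounded_bilinear.FDERIV[OF assms(1) smooth_on_has_derivative[OF assms(2,4)]
      smooth_on_has_derivative[OF assms(3,4)]], of X]
  by (simp add: vf_deriv_def add.commute)

lemmas vf_deriv_lorentz = vf_deriv_bilinear[OF bounded_bilinear_lorentz]
  and vf_deriv_wedge = vf_deriv_bilinear[OF bounded_bilinear_wedge]
  and vf_deriv_mult = vf_deriv_bilinear[OF bounded_bilinear_mult]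
  and vf_deriv_scaleR = vf_deriv_bilinear[OF bounded_bilinear_scaleR]

lemma vf_deriv_const: "vf_deriv X (\<lambda>q. c) p = 0"
  by (simp add: vf_deriv_def)

lemma vf_deriv_add:
  "smooth_on \<phi> V \<Longrightarrow> smooth_on \<eta> V \<Longrightarrow> p \<in> V \<Longrightarrow>
    vf_deriv X (\<lambda>q. \<phi> q + \<eta> q) p = vf_deriv X \<phi> p + vf_deriv X \<eta> p"
  using vf_deriv_eqI[OF has_derivative_add[OF smooth_on_has_derivative smooth_on_has_derivative]]
  by (simp add: vf_deriv_def)

lemma vf_deriv_uminus: "vf_deriv X (\<lambda>q. - \<phi> q) p = - vf_deriv X \<phi> p" if "smooth_on \<phi> V" "p \<in> V"
  using vf_deriv_eqI[OF has_derivative_minus[OF smooth_on_has_derivative[OF that]]]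
  by (simp add: vf_deriv_def)

lemma vf_deriv_cong:
  assumes "open V" "p \<in> V" "\<And>q. q \<in> V \<Longrightarrow> \<phi> q = \<eta> q" "smooth_on \<phi> V"
  shows "vf_deriv X \<phi> p = vf_deriv X \<eta> p"
  using vf_deriv_eqI[OF has_derivative_transform_within_open[OF smooth_on_has_derivative[OF assms(4,2)]
      assms(1,2,3)]]
  by (simp add: vf_deriv_def)

text \<open>The product rule for q \<mapsto> d\<phi>_q (Y q). The first summand freezes Y at p and
  is the second derivative, symmetric in X and Y; only the second summand survives in a
  commutator.\<close>

lemma vf_deriv_vf_deriv:
  fixes \<phi> :: "real^2 \<Rightarrow> 'b::real_normed_vector"
  assumes "open V" "smooth_on \<phi> V" "smooth_on Y V" "p \<in> V"
  shows "vf_deriv X (vf_deriv Y \<phi>) p =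
    frechet_derivative (\<lambda>q. frechet_derivative \<phi> (at q) (Y p)) (at p) (X p)
    + frechet_derivative \<phi> (at p) (vf_deriv X Y p)"
proof -
  have expand: "frechet_derivative \<phi> (at q) v = (\<Sum>b\<in>Basis. (v \<bullet> b) *\<^sub>R frechet_derivative \<phi> (at q) b)"
    if "q \<in> V" for q v
  proof -
    interpret bounded_linear "frechet_derivative \<phi> (at q)"
      using smooth_on_bounded_linear_deriv[OF assms(2) that] .
    show ?thesis
      by (subst euclidean_representation[of v, symmetric]) (simp add: sum scaleR)
  qed
  let ?d = "\<lambda>b. frechet_derivative (\<lambda>q. frechet_derivative \<phi> (at q) b) (at p)"
  have d: "((\<lambda>q. frechet_derivative \<phi> (at q) b) has_derivative ?d b) (at p)" for b
    using smooth_on_has_derivative[OF smooth_on_deriv[OF assms(2)] assms(4)] .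
  have "((\<lambda>q. \<Sum>b\<in>Basis. (Y p \<bullet> b) *\<^sub>R frechet_derivative \<phi> (at q) b) has_derivative
      (\<lambda>v. \<Sum>b\<in>Basis. (Y p \<bullet> b) *\<^sub>R ?d b v)) (at p)"
    by (intro has_derivative_sum has_derivative_scaleR_right d)
  then have "((\<lambda>q. frechet_derivative \<phi> (at q) (Y p)) has_derivative
      (\<lambda>v. \<Sum>b\<in>Basis. (Y p \<bullet> b) *\<^sub>R ?d b v)) (at p)"
    by (rule has_derivative_transform_within_open[OF _ assms(1,4)]) (simp flip: expand)
  then have 1: "?d (Y p) = (\<lambda>v. \<Sum>b\<in>Basis. (Y p \<bullet> b) *\<^sub>R ?d b v)"
    by (rule frechet_derivative_at[symmetric])
  have "((\<lambda>q. Y q \<bullet> b) has_derivative (\<lambda>v. frechet_derivative Y (at p) v \<bullet> b)) (at p)" for b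
    using bounded_linear.has_derivative[OF bounded_linear_inner_left smooth_on_has_derivative[OF assms(3,4)]] .
  then have "((\<lambda>q. \<Sum>b\<in>Basis. (Y q \<bullet> b) *\<^sub>R frechet_derivative \<phi> (at q) b) has_derivative
     (\<lambda>v. \<Sum>b\<in>Basis. (Y p \<bullet> b) *\<^sub>R ?d b v + (frechet_derivative Y (at p) v \<bullet> b) *\<^sub>R frechet_derivative \<phi> (at p) b)) (at p)"
    using has_derivative_scaleR[OF _ d] by (intro has_derivative_sum) blast
  then have "(vf_deriv Y \<phi> has_derivative
     (\<lambda>v. \<Sum>b\<in>Basis. (Y p \<bullet> b) *\<^sub>R ?d b v + (frechet_derivative Y (at p) v \<bullet> b) *\<^sub>R frechet_derivative \<phi> (at p) b)) (at p)"
    by (rule has_derivative_transform_within_open[OF _ assms(1,4)]) (simp only: vf_deriv_def expand[symmetric])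
  from vf_deriv_eqI[OF this, of X] have "vf_deriv X (vf_deriv Y \<phi>) p =
      (\<Sum>b\<in>Basis. (Y p \<bullet> b) *\<^sub>R ?d b (X p))
      + (\<Sum>b\<in>Basis. (vf_deriv X Y p \<bullet> b) *\<^sub>R frechet_derivative \<phi> (at p) b)"
    unfolding sum.distrib vf_deriv_def .
  then show ?thesis
    unfolding 1 expand[OF assms(4), of "vf_deriv X Y p", symmetric] .
qed

lemma vf_deriv_commutator:
  fixes \<phi> :: "real^2 \<Rightarrow> 'b::euclidean_space"
  assumes "open V" "smooth_on \<phi> V" "smooth_on X V" "smooth_on Y V" "p \<in> V"
  shows "vf_deriv X (vf_deriv Y \<phi>) p - vf_deriv Y (vf_deriv X \<phi>) p
    = frechet_derivative \<phi> (at p) (vf_deriv X Y p - vf_deriv Y X p)"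
proof -
  interpret bounded_linear "frechet_derivative \<phi> (at p)"
    using smooth_on_bounded_linear_deriv[OF assms(2,5)] .
  show ?thesis
    using second_derivative_symmetric[OF assms(1,2,5), of "Y p" "X p"]
    by (simp add: vf_deriv_vf_deriv[OF assms(1,2,4,5)] vf_deriv_vf_deriv[OF assms(1,2,3,5)] diff)
qed

section \<open>Moving frames on a quadric\<close>

locale framed_patch =
  fixes x :: "real^2 \<Rightarrow> real^4" and V :: "(real^2) set" and E :: "2 \<Rightarrow> real^2 \<Rightarrow> real^2"
    and r \<epsilon> :: real
  assumes frame: "tangent_frame x V E" and smooth_x: "smooth_on x V"
    and r_pos: "r > 0" and eps: "\<epsilon> = 1 \<or> \<epsilon> = -1"
    and quadric: "\<And>p. p \<in> V \<Longrightarrow> lorentz (x p) (x p) = \<epsilon> / r^2"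
    and basis: "\<And>p. p \<in> V \<Longrightarrow> det (vector [E 1 p, E 2 p] :: real^2^2) \<noteq> 0"
begin

definition e :: "2 \<Rightarrow> real^2 \<Rightarrow> real^4" where "e i = vf_deriv (E i) x"
definition \<xi> :: "real^2 \<Rightarrow> real^4" where "\<xi> p = r *\<^sub>R x p"
definition N :: "real^2 \<Rightarrow> real^4" where "N p = - \<epsilon> *\<^sub>R lcross (e 1 p) (e 2 p) (\<xi> p)"
definition D :: "2 \<Rightarrow> (real^2 \<Rightarrow> 'b::real_normed_vector) \<Rightarrow> real^2 \<Rightarrow> 'b" where "D i = vf_deriv (E i)"
text \<open>The connection form of the tangent frame, evaluated on \<open>E i\<close>.\<close>

definition \<omega> :: "2 \<Rightarrow> real^2 \<Rightarrow> real" where "\<omega> i p = lorentz (D i (e 1) p) (e 2 p)"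
text \<open>The second fundamental form in the direction N. Since <N,N> = -\<epsilon>, the
  N-component of D_i e_j is -\<epsilon> A_ij N.\<close>

definition A :: "2 \<Rightarrow> 2 \<Rightarrow> real^2 \<Rightarrow> real" where "A i j p = lorentz (D i (e j) p) (N p)"

lemma open_V: "open V" using frame by (simp add: tangent_frame_def)

lemma smooth_E: "smooth_on (E i) V" using frame by (simp add: tangent_frame_def)

lemma smooth_D: "smooth_on \<phi> V \<Longrightarrow> smooth_on (D i \<phi>) V"
  unfolding D_def by (rule smooth_on_vf_deriv[OF open_V smooth_E])

lemma smooth_e: "smooth_on (e i) V"
  unfolding e_def by (rule smooth_on_vf_deriv[OF open_V smooth_E smooth_x])

lemma smooth_\<xi>: "smooth_on \<xi> V"
  unfolding \<xi>_def by (intro smooth_on_scaleR open_V smooth_on_const smooth_x)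

lemma smooth_N: "smooth_on N V"
  unfolding N_def by (intro smooth_on_scaleR smooth_on_lcross open_V smooth_on_const smooth_e smooth_\<xi>)

lemmas smooth_lorentz = smooth_on_bilinear[OF bounded_bilinear_lorentz open_V]

lemma smooth_\<omega>: "smooth_on (\<omega> i) V"
  unfolding \<omega>_def by (intro smooth_lorentz smooth_D smooth_e)

lemma smooth_A: "smooth_on (A i j) V"
  unfolding A_def by (intro smooth_lorentz smooth_D smooth_e smooth_N)

lemmas D_lorentz = vf_deriv_lorentz[of _ V _ _ "E i" for i, folded D_def]
  and D_wedge = vf_deriv_wedge[of _ V _ _ "E i" for i, folded D_def]
  and D_mult = vf_deriv_mult[of _ V _ _ "E i" for i, folded D_def]
  and D_const = vf_deriv_const[of "E i" for i, folded D_def]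
  and D_add = vf_deriv_add[of _ V _ _ "E i" for i, folded D_def]
  and D_uminus = vf_deriv_uminus[of _ V _ "E i" for i, folded D_def]
  and D_cong = vf_deriv_cong[OF open_V, of _ _ _ "E i" for i, folded D_def]

lemma D_\<xi>: "p \<in> V \<Longrightarrow> D i \<xi> p = r *\<^sub>R e i p"
  using vf_deriv_scaleR[OF smooth_on_const[of r] smooth_x, of p "E i"]
  by (simp add: D_def e_def \<xi>_def [abs_def] vf_deriv_const)

lemma \<xi>_\<xi>: "p \<in> V \<Longrightarrow> lorentz (\<xi> p) (\<xi> p) = \<epsilon>"
  using quadric r_pos by (simp add: \<xi>_def lorentz_simps power2_eq_square)

lemma e_e: "p \<in> V \<Longrightarrow> lorentz (e i p) (e j p) = (if i = j then 1 else 0)"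
  using frame by (simp add: tangent_frame_def e_def)

lemma e_\<xi>: assumes "p \<in> V" shows "lorentz (e i p) (\<xi> p) = 0"
proof -
  have "D i (\<lambda>q. lorentz (\<xi> q) (\<xi> q)) p = 0"
    using D_cong[OF assms \<xi>_\<xi> smooth_lorentz[OF smooth_\<xi> smooth_\<xi>]] by (simp add: D_const)
  then show ?thesis
    using assms r_pos
    by (simp add: D_lorentz[OF smooth_\<xi> smooth_\<xi>] D_\<xi> lorentz_simps lorentz_commute)
qed

lemma N_orth:
  assumes "p \<in> V"
  shows "lorentz (e i p) (N p) = 0" "lorentz (\<xi> p) (N p) = 0" "lorentz (N p) (N p) = - \<epsilon>"
proof -
  have "lorentz (lcross (e 1 p) (e 2 p) (\<xi> p)) (lcross (e 1 p) (e 2 p) (\<xi> p)) = - \<epsilon>"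
    using lorentz_lcross_lcross[of "e 1 p" "e 2 p" "\<xi> p"] assms by (simp add: e_e e_\<xi> \<xi>_\<xi>)
  then show "lorentz (e i p) (N p) = 0" "lorentz (\<xi> p) (N p) = 0" "lorentz (N p) (N p) = - \<epsilon>"
    using lcross_orthogonal[of "e 1 p" "e 2 p" "\<xi> p"] eps exhaust_2[of i]
    by (auto simp: N_def lorentz_simps lorentz_commute)
qed

lemma gram_swap:
  "p \<in> V \<Longrightarrow> lorentz (\<xi> p) (e i p) = 0" "p \<in> V \<Longrightarrow> lorentz (N p) (e i p) = 0"
  "p \<in> V \<Longrightarrow> lorentz (N p) (\<xi> p) = 0"
  using e_\<xi> N_orth by (simp_all add: lorentz_commute)

lemma expansion:
  assumes "p \<in> V"
  shows "u = lorentz u (e 1 p) *\<^sub>R e 1 p + lorentz u (e 2 p) *\<^sub>R e 2 p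
    + (\<epsilon> * lorentz u (\<xi> p)) *\<^sub>R \<xi> p - (\<epsilon> * lorentz u (N p)) *\<^sub>R N p"
proof -
  define F :: "4 \<Rightarrow> real^4" where
    "F = (\<lambda>i. if i = 1 then e 1 p else if i = 2 then e 2 p else if i = 3 then \<xi> p else N p)"
  have F: "F 1 = e 1 p" "F 2 = e 2 p" "F 3 = \<xi> p" "F 4 = N p" by (simp_all add: F_def)
  have "orthonormal_frame F"
    unfolding orthonormal_frame_def forall_4 F
    using eps by (auto simp: assms e_e e_\<xi> N_orth \<xi>_\<xi> gram_swap)
  from orthonormal_frame_expansion[OF this, of u] show ?thesis
    by (simp add: sum_4 F e_e \<xi>_\<xi> N_orth assms)
qed

lemma parseval:
  assumes "p \<in> V"
  shows "lorentz u v = lorentz u (e 1 p) * lorentz v (e 1 p) + lorentz u (e 2 p) * lorentz v (e 2 p)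
    + \<epsilon> * lorentz u (\<xi> p) * lorentz v (\<xi> p) - \<epsilon> * lorentz u (N p) * lorentz v (N p)"
proof -
  have "lorentz u v = lorentz u (lorentz v (e 1 p) *\<^sub>R e 1 p + lorentz v (e 2 p) *\<^sub>R e 2 p
    + (\<epsilon> * lorentz v (\<xi> p)) *\<^sub>R \<xi> p - (\<epsilon> * lorentz v (N p)) *\<^sub>R N p)"
    using expansion[OF assms, of v] by simp
  then show ?thesis by (simp add: lorentz_simps algebra_simps)
qed

section \<open>Structure equations of the frame\<close>

text \<open>Differentiating a constant product moves the derivative to the other factor; the
  components of the derivatives of e, \<xi> and N are read off from this.\<close>

lemma D_orthogonal:
  assumes "p \<in> V" "smooth_on \<phi> V" "smooth_on \<eta> V" "\<And>q. q \<in> V \<Longrightarrow> lorentz (\<phi> q) (\<eta> q) = c"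
  shows "lorentz (D i \<phi> p) (\<eta> p) = - lorentz (D i \<eta> p) (\<phi> p)"
  using D_cong[OF assms(1,4) smooth_lorentz[OF assms(2,3)], of i] D_lorentz[OF assms(2,3,1), of i]
  by (simp add: D_const lorentz_commute)

lemma De_e:
  assumes "p \<in> V"
  shows "lorentz (D i (e 1) p) (e 1 p) = 0" "lorentz (D i (e 2) p) (e 2 p) = 0"
    "lorentz (D i (e 1) p) (e 2 p) = \<omega> i p" "lorentz (D i (e 2) p) (e 1 p) = - \<omega> i p"
proof -
  have "lorentz (D i (e j) p) (e k p) = - lorentz (D i (e k) p) (e j p)" for j k
    by (rule D_orthogonal[OF assms smooth_e smooth_e e_e])
  from this[of 1 1] this[of 2 2] this[of 2 1] show
    "lorentz (D i (e 1) p) (e 1 p) = 0" "lorentz (D i (e 2) p) (e 2 p) = 0"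
    "lorentz (D i (e 1) p) (e 2 p) = \<omega> i p" "lorentz (D i (e 2) p) (e 1 p) = - \<omega> i p"
    by (simp_all add: \<omega>_def)
qed

lemma De_\<xi>: "p \<in> V \<Longrightarrow> lorentz (D i (e j) p) (\<xi> p) = (if i = j then - r else 0)"
  using D_orthogonal[OF _ smooth_e smooth_\<xi> e_\<xi>, of p i j] by (simp add: D_\<xi> lorentz_simps e_e)

lemma De_N: "lorentz (D i (e j) p) (N p) = A i j p"
  by (simp add: A_def)

lemma DN:
  assumes "p \<in> V"
  shows "lorentz (D i N p) (N p) = 0" "lorentz (D i N p) (\<xi> p) = 0" "lorentz (D i N p) (e j p) = - A i j p"
  using D_orthogonal[OF assms smooth_N smooth_N N_orth(3), of i]
    D_orthogonal[OF assms smooth_\<xi> smooth_N N_orth(2), of i]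
    D_orthogonal[OF assms smooth_e smooth_N N_orth(1), of i j]
  by (simp_all add: D_\<xi> assms lorentz_simps N_orth De_N)

text \<open>The differential of x sends the Lie bracket of \<open>E 1\<close> and \<open>E 2\<close>
  to D_1 e_2 - D_2 e_1, because second derivatives commute. Pairing with e_1 and e_2 then identifies
  the coefficients.\<close>

lemma bracket:
  assumes "p \<in> V"
  shows "vf_deriv (E 1) (E 2) p - vf_deriv (E 2) (E 1) p = - \<omega> 1 p *\<^sub>R E 1 p - \<omega> 2 p *\<^sub>R E 2 p"
    "D 1 (e 2) p - D 2 (e 1) p = - \<omega> 1 p *\<^sub>R e 1 p - \<omega> 2 p *\<^sub>R e 2 p"
proof -
  interpret dx: bounded_linear "frechet_derivative x (at p)"
    using smooth_on_bounded_linear_deriv[OF smooth_x assms] .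
  obtain s t where st: "vf_deriv (E 1) (E 2) p - vf_deriv (E 2) (E 1) p = s *\<^sub>R E 1 p + t *\<^sub>R E 2 p"
    using plane_basis[OF basis[OF assms]] .
  have "D 1 (e 2) p - D 2 (e 1) p = frechet_derivative x (at p) (s *\<^sub>R E 1 p + t *\<^sub>R E 2 p)"
    using vf_deriv_commutator[OF open_V smooth_x smooth_E[of 1] smooth_E[of 2] assms]
    unfolding st D_def e_def .
  also have "\<dots> = s *\<^sub>R e 1 p + t *\<^sub>R e 2 p"
    by (simp add: dx.add dx.scaleR e_def vf_deriv_def)
  finally have *: "D 1 (e 2) p - D 2 (e 1) p = s *\<^sub>R e 1 p + t *\<^sub>R e 2 p" .
  have "s = lorentz (D 1 (e 2) p - D 2 (e 1) p) (e 1 p)" "t = lorentz (D 1 (e 2) p - D 2 (e 1) p) (e 2 p)"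
    unfolding * using assms by (simp_all add: lorentz_simps e_e)
  then have "s = - \<omega> 1 p" "t = - \<omega> 2 p"
    using assms by (simp_all add: lorentz_simps De_e)
  then show "vf_deriv (E 1) (E 2) p - vf_deriv (E 2) (E 1) p = - \<omega> 1 p *\<^sub>R E 1 p - \<omega> 2 p *\<^sub>R E 2 p"
    "D 1 (e 2) p - D 2 (e 1) p = - \<omega> 1 p *\<^sub>R e 1 p - \<omega> 2 p *\<^sub>R e 2 p"
    using st * by simp_all
qed

lemma commutator:
  fixes \<phi> :: "real^2 \<Rightarrow> 'b::euclidean_space"
  assumes "p \<in> V" "smooth_on \<phi> V"
  shows "D 1 (D 2 \<phi>) p - D 2 (D 1 \<phi>) p = - \<omega> 1 p *\<^sub>R D 1 \<phi> p - \<omega> 2 p *\<^sub>R D 2 \<phi> p"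
proof -
  interpret d: bounded_linear "frechet_derivative \<phi> (at p)"
    using smooth_on_bounded_linear_deriv[OF assms(2,1)] .
  have "D 1 (D 2 \<phi>) p - D 2 (D 1 \<phi>) p
      = frechet_derivative \<phi> (at p) (- \<omega> 1 p *\<^sub>R E 1 p - \<omega> 2 p *\<^sub>R E 2 p)"
    using vf_deriv_commutator[OF open_V assms(2) smooth_E[of 1] smooth_E[of 2] assms(1)]
    unfolding bracket(1)[OF assms(1)] D_def .
  also have "\<dots> = - \<omega> 1 p *\<^sub>R D 1 \<phi> p - \<omega> 2 p *\<^sub>R D 2 \<phi> p"
    by (simp add: d.diff d.neg d.scaleR D_def vf_deriv_def)
  finally show ?thesis .
qed

text \<open>D_1 e_2 - D_2 e_1 is the image of a Lie bracket, hence tangent, so its product with N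
  vanishes.\<close>

lemma A_sym: assumes "p \<in> V" shows "A 2 1 p = A 1 2 p"
proof -
  have "lorentz (D 1 (e 2) p - D 2 (e 1) p) (N p) = 0"
    unfolding bracket(2)[OF assms] using assms by (simp add: lorentz_simps N_orth)
  then show ?thesis by (simp add: lorentz_simps A_def)
qed

lemma D_A_sym: "p \<in> V \<Longrightarrow> D k (A 2 1) p = D k (A 1 2) p"
  by (rule D_cong[OF _ A_sym smooth_A])

lemma DN_De:
  assumes "p \<in> V"
  shows "lorentz (D i N p) (D k (e 1) p) = - A i 2 p * \<omega> k p" "lorentz (D i N p) (D k (e 2) p) = A i 1 p * \<omega> k p"
    "lorentz (D i N p) (D k N p) = A i 1 p * A k 1 p + A i 2 p * A k 2 p"
  using parseval[OF assms, of "D i N p"] by (simp_all add: DN De_e assms)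

text \<open>The scalar identities of \<open>DN\<close> are differentiated instead of the expansion
  of D_i N, so only products of first derivatives remain to be evaluated.\<close>

lemma DDN:
  assumes "p \<in> V"
  shows "lorentz (D k (D i N) p) (e 1 p) = - D k (A i 1) p + A i 2 p * \<omega> k p"
    "lorentz (D k (D i N) p) (e 2 p) = - D k (A i 2) p - A i 1 p * \<omega> k p"
    "lorentz (D k (D i N) p) (N p) = - (A i 1 p * A k 1 p + A i 2 p * A k 2 p)"
proof -
  have *: "D k (\<lambda>q. lorentz (D i N q) (e j q)) p = - D k (A i j) p" for j
    using D_cong[OF assms DN(3) smooth_lorentz[OF smooth_D[OF smooth_N] smooth_e], of k i j] D_uminus[OF smooth_A assms]
    by simp
  show "lorentz (D k (D i N) p) (e 1 p) = - D k (A i 1) p + A i 2 p * \<omega> k p"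
    "lorentz (D k (D i N) p) (e 2 p) = - D k (A i 2) p - A i 1 p * \<omega> k p"
    using *[of 1] *[of 2] by (simp_all add: D_lorentz[OF smooth_D[OF smooth_N] smooth_e assms] DN_De assms)
  have "D k (\<lambda>q. lorentz (D i N q) (N q)) p = 0"
    using D_cong[OF assms DN(1) smooth_lorentz[OF smooth_D[OF smooth_N] smooth_N], of k i] by (simp add: D_const)
  then show "lorentz (D k (D i N) p) (N p) = - (A i 1 p * A k 1 p + A i 2 p * A k 2 p)"
    by (simp add: D_lorentz[OF smooth_D[OF smooth_N] smooth_N assms] DN_De assms)
qed

text \<open>The tangential components of the commutator identity applied to N.\<close>

lemma codazzi:
  assumes "p \<in> V"
  shows "D 2 (A 1 1) p - D 1 (A 1 2) p = \<omega> 1 p * (A 1 1 p - A 2 2 p) + 2 * \<omega> 2 p * A 1 2 p"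
    "D 2 (A 1 2) p - D 1 (A 2 2) p = 2 * \<omega> 1 p * A 1 2 p - \<omega> 2 p * (A 1 1 p - A 2 2 p)"
proof -
  have "lorentz (D 1 (D 2 N) p - D 2 (D 1 N) p) (e j p) = lorentz (- \<omega> 1 p *\<^sub>R D 1 N p - \<omega> 2 p *\<^sub>R D 2 N p) (e j p)" for j
    using commutator[OF assms smooth_N] by simp
  from this[of 1] this[of 2] show
    "D 2 (A 1 1) p - D 1 (A 1 2) p = \<omega> 1 p * (A 1 1 p - A 2 2 p) + 2 * \<omega> 2 p * A 1 2 p"
    "D 2 (A 1 2) p - D 1 (A 2 2) p = 2 * \<omega> 1 p * A 1 2 p - \<omega> 2 p * (A 1 1 p - A 2 2 p)"
    by (simp_all add: lorentz_simps DDN DN assms A_sym D_A_sym algebra_simps)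
qed

text \<open>The commutator identity applied to e_1 and paired with e_2. The left side is minus the
  Gaussian curvature; the term r^2 is the contribution of the umbilic normal \<xi>.\<close>

lemma gauss:
  assumes "p \<in> V"
  shows "D 1 (\<omega> 2) p - D 2 (\<omega> 1) p + \<omega> 1 p * \<omega> 1 p + \<omega> 2 p * \<omega> 2 p
    = \<epsilon> * (A 1 1 p * A 2 2 p - A 1 2 p * A 1 2 p - r^2)"
proof -
  have *: "D k (\<omega> i) p = lorentz (D k (D i (e 1)) p) (e 2 p) + lorentz (D i (e 1) p) (D k (e 2) p)" for i k
    unfolding \<omega>_def by (rule D_lorentz[OF smooth_D[OF smooth_e] smooth_e assms])
  have "lorentz (D 1 (D 2 (e 1)) p - D 2 (D 1 (e 1)) p) (e 2 p)
    = lorentz (- \<omega> 1 p *\<^sub>R D 1 (e 1) p - \<omega> 2 p *\<^sub>R D 2 (e 1) p) (e 2 p)"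
    using commutator[OF assms smooth_e] by simp
  then have "D 1 (\<omega> 2) p - D 2 (\<omega> 1) p + \<omega> 1 p * \<omega> 1 p + \<omega> 2 p * \<omega> 2 p
     = lorentz (D 2 (e 1) p) (D 1 (e 2) p) - lorentz (D 1 (e 1) p) (D 2 (e 2) p)"
    by (simp add: * lorentz_simps De_e assms)
  also have "\<dots> = \<epsilon> * (A 1 1 p * A 2 2 p - A 1 2 p * A 1 2 p - r^2)"
    using parseval[OF assms, of "D 2 (e 1) p" "D 1 (e 2) p"] parseval[OF assms, of "D 1 (e 1) p" "D 2 (e 2) p"]
    by (simp add: De_e De_\<xi> De_N assms A_sym power2_eq_square algebra_simps)
  finally show ?thesis .
qed

section \<open>Connection and Laplacian in the frame\<close>

text \<open>The description in \<open>levi_civita\<close> has only one solution: the frame spans the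
  coordinate plane and has orthonormal image, so a vector whose image is orthogonal to both e_1 and
  e_2 is zero.\<close>

lemma levi_civita_frame:
  assumes "p \<in> V" "\<And>w. lorentz u (frechet_derivative x (at p) w) = lorentz (D i (e j) p) (frechet_derivative x (at p) w)"
    "u = frechet_derivative x (at p) z" "E j = Y" "E i = X"
  shows "levi_civita x X Y p = z"
  unfolding levi_civita_def
proof (rule the_equality)
  have eq: "vf_deriv X (vf_deriv Y x) p = D i (e j) p" using assms(4,5) by (simp add: D_def e_def)
  show "\<forall>w. lorentz (frechet_derivative x (at p) z) (frechet_derivative x (at p) w) =
        lorentz (vf_deriv X (vf_deriv Y x) p) (frechet_derivative x (at p) w)"
    using assms(2,3) eq by simp
  fix z' assume z': "\<forall>w. lorentz (frechet_derivative x (at p) z') (frechet_derivative x (at p) w) =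
        lorentz (vf_deriv X (vf_deriv Y x) p) (frechet_derivative x (at p) w)"
  interpret dx: bounded_linear "frechet_derivative x (at p)"
    using smooth_on_bounded_linear_deriv[OF smooth_x assms(1)] .
  obtain s t where st: "z' - z = s *\<^sub>R E 1 p + t *\<^sub>R E 2 p"
    using plane_basis[OF basis[OF assms(1)]] .
  have dE: "frechet_derivative x (at p) (E k p) = e k p" for k by (simp add: e_def vf_deriv_def)
  have "lorentz (frechet_derivative x (at p) (z' - z)) (frechet_derivative x (at p) (E k p)) = 0" for k
    using z' assms(2,3) eq by (simp add: dx.diff lorentz_simps)
  from this[of 1] this[of 2] have "s = 0" "t = 0"
    using assms(1) by (simp_all add: st dx.add dx.scaleR dE lorentz_simps e_e)
  then show "z' = z" using st by simp
qed

lemma levi_civita_E: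
  assumes "p \<in> V"
  shows "levi_civita x (E 1) (E 1) p = \<omega> 1 p *\<^sub>R E 2 p" "levi_civita x (E 2) (E 2) p = - \<omega> 2 p *\<^sub>R E 1 p"
proof -
  interpret dx: bounded_linear "frechet_derivative x (at p)"
    using smooth_on_bounded_linear_deriv[OF smooth_x assms(1)] .
  have dE: "frechet_derivative x (at p) (E k p) = e k p" for k by (simp add: e_def vf_deriv_def)
  have tangent: "lorentz u (frechet_derivative x (at p) w) = lorentz v (frechet_derivative x (at p) w)"
    if "\<And>k. lorentz u (e k p) = lorentz v (e k p)" for u v w
  proof -
    obtain s t where "w = s *\<^sub>R E 1 p + t *\<^sub>R E 2 p"
      using plane_basis[OF basis[OF assms(1)]] .
    then show ?thesis using that by (simp add: dx.add dx.scaleR dE lorentz_simps)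
  qed
  show "levi_civita x (E 1) (E 1) p = \<omega> 1 p *\<^sub>R E 2 p"
  proof (rule levi_civita_frame[OF assms _ _ refl refl])
    show "lorentz (\<omega> 1 p *\<^sub>R e 2 p) (frechet_derivative x (at p) w) = lorentz (D 1 (e 1) p) (frechet_derivative x (at p) w)" for w
    proof (rule tangent)
      show "lorentz (\<omega> 1 p *\<^sub>R e 2 p) (e k p) = lorentz (D 1 (e 1) p) (e k p)" for k
        using exhaust_2[of k] assms by (auto simp: lorentz_simps e_e De_e)
    qed
  qed (simp add: dx.scaleR dE)
  show "levi_civita x (E 2) (E 2) p = - \<omega> 2 p *\<^sub>R E 1 p"
  proof (rule levi_civita_frame[OF assms _ _ refl refl])
    show "lorentz (- \<omega> 2 p *\<^sub>R e 1 p) (frechet_derivative x (at p) w) = lorentz (D 2 (e 2) p) (frechet_derivative x (at p) w)" for w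
    proof (rule tangent)
      show "lorentz (- \<omega> 2 p *\<^sub>R e 1 p) (e k p) = lorentz (D 2 (e 2) p) (e k p)" for k
        using exhaust_2[of k] assms by (auto simp: lorentz_simps e_e De_e)
    qed
  qed (simp add: dx.scaleR dx.neg dE)
qed

lemma laplacian_frame:
  fixes \<phi> :: "real^2 \<Rightarrow> 'b::real_normed_vector"
  assumes "p \<in> V" "smooth_on \<phi> V"
  shows "laplacian x E \<phi> p = \<omega> 1 p *\<^sub>R D 2 \<phi> p - \<omega> 2 p *\<^sub>R D 1 \<phi> p - D 1 (D 1 \<phi>) p - D 2 (D 2 \<phi>) p"
proof -
  interpret d: bounded_linear "frechet_derivative \<phi> (at p)"
    using smooth_on_bounded_linear_deriv[OF assms(2,1)] .
  have "vf_deriv (levi_civita x (E 1) (E 1)) \<phi> p = \<omega> 1 p *\<^sub>R D 2 \<phi> p"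
    "vf_deriv (levi_civita x (E 2) (E 2)) \<phi> p = - \<omega> 2 p *\<^sub>R D 1 \<phi> p"
    unfolding vf_deriv_def D_def levi_civita_E[OF assms(1)] by (simp_all add: d.scaleR d.neg)
  then show ?thesis
    by (simp add: laplacian_def sum_2 D_def)
qed

end

section \<open>Harmonic Gauss maps on a quadric\<close>

context framed_patch
begin

section \<open>The Laplacian of the Gauss map\<close>

lemma D_scaleR: "p \<in> V \<Longrightarrow> smooth_on \<phi> V \<Longrightarrow> D i (\<lambda>q. c *\<^sub>R \<phi> q) p = c *\<^sub>R D i \<phi> p"
  using vf_deriv_scaleR[OF smooth_on_const[of c], of \<phi> V p "E i"] by (simp add: D_def vf_deriv_const)

lemma DD_\<xi>: assumes "p \<in> V" shows "D k (D i \<xi>) p = r *\<^sub>R D k (e i) p"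
  using D_cong[OF assms D_\<xi> smooth_D[OF smooth_\<xi>], of k i] D_scaleR[OF assms smooth_e] by simp

lemma D_const_diff: "p \<in> V \<Longrightarrow> smooth_on \<phi> V \<Longrightarrow> D i (\<lambda>q. c - \<phi> q) p = - D i \<phi> p"
  using D_add[OF smooth_on_const[of c] smooth_on_uminus[OF open_V], of \<phi> p i]
  by (simp add: D_const D_uminus)

lemma D_D_wedge:
  assumes "p \<in> V"
  shows "D i (D i (\<lambda>q. wedge (\<xi> q) (N q))) p =
    r *\<^sub>R wedge (D i (e i) p) (N p) + (r *\<^sub>R wedge (e i p) (D i N p) + r *\<^sub>R wedge (e i p) (D i N p)) + wedge (\<xi> p) (D i (D i N) p)"
proof -
  note W = smooth_on_bilinear[OF bounded_bilinear_wedge open_V]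
  have "D i (D i (\<lambda>q. wedge (\<xi> q) (N q))) p = D i (\<lambda>q. wedge (D i \<xi> q) (N q) + wedge (\<xi> q) (D i N q)) p"
    by (rule D_cong[OF assms]) (simp_all add: D_wedge[OF smooth_\<xi> smooth_N] smooth_D[OF W] smooth_\<xi> smooth_N)
  also have "\<dots> = D i (\<lambda>q. wedge (D i \<xi> q) (N q)) p + D i (\<lambda>q. wedge (\<xi> q) (D i N q)) p"
    using assms by (intro D_add W smooth_D smooth_\<xi> smooth_N)
  finally show ?thesis
    using assms
    by (simp add: D_wedge[OF smooth_D[OF smooth_\<xi>] smooth_N] D_wedge[OF smooth_\<xi> smooth_D[OF smooth_N]]
        DD_\<xi> D_\<xi> wedge_simps)
qed

text \<open>Three cancellations leave only multiples of \<xi>. The terms in e_i \<and> N from the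
  connection cancel those from D_i e_i; the terms in e_1 \<and> e_2 cancel by symmetry of A; the
  N-part of D_i e_i is killed by the wedge with N. Each D_i e_i also has \<xi>-component -\<epsilon>
  r, which contributes one summand \<epsilon> r^2 N.\<close>

lemma laplacian_wedge:
  assumes "p \<in> V"
  shows "laplacian x E (\<lambda>q. wedge (\<xi> q) (N q)) p =
    wedge (\<xi> p) (\<omega> 1 p *\<^sub>R D 2 N p - \<omega> 2 p *\<^sub>R D 1 N p - D 1 (D 1 N) p - D 2 (D 2 N) p + (\<epsilon> * r^2) *\<^sub>R N p + (\<epsilon> * r^2) *\<^sub>R N p)"
proof -
  have De: "D 1 (e 1) p = \<omega> 1 p *\<^sub>R e 2 p - (\<epsilon> * r) *\<^sub>R \<xi> p - (\<epsilon> * A 1 1 p) *\<^sub>R N p"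
    "D 2 (e 2) p = - \<omega> 2 p *\<^sub>R e 1 p - (\<epsilon> * r) *\<^sub>R \<xi> p - (\<epsilon> * A 2 2 p) *\<^sub>R N p"
    using expansion[OF assms, of "D 1 (e 1) p"] expansion[OF assms, of "D 2 (e 2) p"]
    by (simp_all add: De_e De_\<xi> De_N assms)
  have "D i N p = - A i 1 p *\<^sub>R e 1 p - A i 2 p *\<^sub>R e 2 p" for i
    using expansion[OF assms, of "D i N p"] by (simp add: DN assms)
  then have "wedge (e 1 p) (D 1 N p) + wedge (e 2 p) (D 2 N p) = 0"
    using wedge_swap[of "e 2 p" "e 1 p"] by (simp add: wedge_simps A_sym assms)
  then have cross: "r *\<^sub>R wedge (e 1 p) (D 1 N p) + r *\<^sub>R wedge (e 2 p) (D 2 N p) = 0"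
    by (simp flip: scaleR_add_right)
  have first: "r *\<^sub>R wedge (D 1 (e 1) p) (N p) + r *\<^sub>R wedge (D 2 (e 2) p) (N p) =
    (r * \<omega> 1 p) *\<^sub>R wedge (e 2 p) (N p) - (r * \<omega> 2 p) *\<^sub>R wedge (e 1 p) (N p)
    - (\<epsilon> * r^2) *\<^sub>R wedge (\<xi> p) (N p) - (\<epsilon> * r^2) *\<^sub>R wedge (\<xi> p) (N p)"
    by (simp add: De wedge_simps power2_eq_square algebra_simps)
  have sm: "smooth_on (\<lambda>q. wedge (\<xi> q) (N q)) V"
    by (rule smooth_on_bilinear[OF bounded_bilinear_wedge open_V smooth_\<xi> smooth_N])
  have "laplacian x E (\<lambda>q. wedge (\<xi> q) (N q)) p =
      \<omega> 1 p *\<^sub>R (r *\<^sub>R wedge (e 2 p) (N p) + wedge (\<xi> p) (D 2 N p))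
      - \<omega> 2 p *\<^sub>R (r *\<^sub>R wedge (e 1 p) (N p) + wedge (\<xi> p) (D 1 N p))
      - D 1 (D 1 (\<lambda>q. wedge (\<xi> q) (N q))) p - D 2 (D 2 (\<lambda>q. wedge (\<xi> q) (N q))) p"
    unfolding laplacian_frame[OF assms sm]
    by (simp add: D_wedge[OF smooth_\<xi> smooth_N assms] D_\<xi>[OF assms] wedge_simps)
  also have "\<dots> = \<omega> 1 p *\<^sub>R (r *\<^sub>R wedge (e 2 p) (N p) + wedge (\<xi> p) (D 2 N p))
      - \<omega> 2 p *\<^sub>R (r *\<^sub>R wedge (e 1 p) (N p) + wedge (\<xi> p) (D 1 N p))
      - (r *\<^sub>R wedge (D 1 (e 1) p) (N p) + r *\<^sub>R wedge (D 2 (e 2) p) (N p))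
      - (r *\<^sub>R wedge (e 1 p) (D 1 N p) + r *\<^sub>R wedge (e 2 p) (D 2 N p))
      - (r *\<^sub>R wedge (e 1 p) (D 1 N p) + r *\<^sub>R wedge (e 2 p) (D 2 N p))
      - wedge (\<xi> p) (D 1 (D 1 N) p) - wedge (\<xi> p) (D 2 (D 2 N) p)"
    unfolding D_D_wedge[OF assms] by simp
  also have "\<dots> = wedge (\<xi> p) (\<omega> 1 p *\<^sub>R D 2 N p - \<omega> 2 p *\<^sub>R D 1 N p - D 1 (D 1 N) p
      - D 2 (D 2 N) p + (\<epsilon> * r^2) *\<^sub>R N p + (\<epsilon> * r^2) *\<^sub>R N p)"
    unfolding first cross wedge_simps by (simp add: scaleR_add_right mult.commute)
  finally show ?thesis .
qed

text \<open>If \<xi> \<and> y vanishes, y is parallel to \<xi> and orthogonal to e_1, e_2 and N. The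
  first two products give a divergence of A, which combines with \<open>codazzi\<close> into the
  gradient of the trace; the third gives the norm of A.\<close>

lemma harmonic_equations:
  assumes "p \<in> V" "laplacian x E (\<lambda>q. wedge (\<xi> q) (N q)) p = 0"
  shows "D 1 (A 1 1) p + D 1 (A 2 2) p = 0" "D 2 (A 1 1) p + D 2 (A 2 2) p = 0"
    "A 1 1 p * A 1 1 p + 2 * (A 1 2 p * A 1 2 p) + A 2 2 p * A 2 2 p = 2 * r^2"
proof -
  define y where "y = \<omega> 1 p *\<^sub>R D 2 N p - \<omega> 2 p *\<^sub>R D 1 N p - D 1 (D 1 N) p - D 2 (D 2 N) p
    + (\<epsilon> * r^2) *\<^sub>R N p + (\<epsilon> * r^2) *\<^sub>R N p"
  have "wedge (\<xi> p) y = 0"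
    using assms(2) by (simp add: laplacian_wedge[OF assms(1)] y_def)
  moreover have "lorentz (\<xi> p) (\<xi> p) \<noteq> 0" using assms(1) eps by (auto simp: \<xi>_\<xi>)
  ultimately obtain c where c: "y = c *\<^sub>R \<xi> p" using wedge_eq_0 by blast
  have "lorentz y (e 1 p) = 0" "lorentz y (e 2 p) = 0" "lorentz y (N p) = 0"
    unfolding c using assms(1) by (simp_all add: lorentz_simps gram_swap N_orth)
  then have eqs: "D 1 (A 1 1) p + D 2 (A 1 2) p = 2 * \<omega> 1 p * A 1 2 p - \<omega> 2 p * (A 1 1 p - A 2 2 p)"
    "D 1 (A 1 2) p + D 2 (A 2 2) p = - \<omega> 1 p * (A 1 1 p - A 2 2 p) - 2 * \<omega> 2 p * A 1 2 p"
    "A 1 1 p * A 1 1 p + 2 * (A 1 2 p * A 1 2 p) + A 2 2 p * A 2 2 p = 2 * r^2 * (\<epsilon> * \<epsilon>)"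
    unfolding y_def lorentz_simps using assms(1)
    by (simp_all add: DN DDN N_orth gram_swap A_sym D_A_sym algebra_simps)
  show "D 1 (A 1 1) p + D 1 (A 2 2) p = 0" "D 2 (A 1 1) p + D 2 (A 2 2) p = 0"
    using eqs(1,2) codazzi[OF assms(1)] by simp_all
  show "A 1 1 p * A 1 1 p + 2 * (A 1 2 p * A 1 2 p) + A 2 2 p * A 2 2 p = 2 * r^2"
    using eqs(3) eps by auto
qed

lemma D_zero_constant:
  assumes "convex V" "smooth_on \<phi> V" "\<And>p. p \<in> V \<Longrightarrow> D 1 \<phi> p = 0" "\<And>p. p \<in> V \<Longrightarrow> D 2 \<phi> p = 0"
  obtains c where "\<And>p. p \<in> V \<Longrightarrow> \<phi> p = c"
proof -
  have "(\<phi> has_derivative (\<lambda>h. 0)) (at p within V)" if p: "p \<in> V" for p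
  proof -
    interpret d: bounded_linear "frechet_derivative \<phi> (at p)"
      using smooth_on_bounded_linear_deriv[OF assms(2) p] .
    have "frechet_derivative \<phi> (at p) h = 0" for h
    proof -
      obtain s t where "h = s *\<^sub>R E 1 p + t *\<^sub>R E 2 p"
        using plane_basis[OF basis[OF p]] .
      then show ?thesis using assms(3,4)[OF p] by (simp add: d.add d.scaleR D_def vf_deriv_def)
    qed
    then have "frechet_derivative \<phi> (at p) = (\<lambda>h. 0)" by blast
    then show ?thesis
      using smooth_on_has_derivative[OF assms(2) p] has_derivative_at_withinI by metis
  qed
  from has_derivative_zero_constant[OF assms(1) this] that show thesis by blast
qed

text \<open>If the eigenvalues of the shape operator were distinct, the connection form would be, up to
  sign, half the differential of the angle of the principal directions, hence closed, and the Gauss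
  equation would give \<open>det A = r\<^sup>2\<close>.\<close>

lemma constant_shape_umbilic:
  assumes p: "p \<in> V"
    and trace: "\<And>q. q \<in> V \<Longrightarrow> A 1 1 q + A 2 2 q = 2 * h"
    and norm: "\<And>q. q \<in> V \<Longrightarrow> A 1 1 q * A 1 1 q + 2 * (A 1 2 q * A 1 2 q) + A 2 2 q * A 2 2 q = 2 * r^2"
  shows "h^2 = r^2"
proof (rule ccontr)
  assume ne: "h^2 \<noteq> r^2"
  \<comment> \<open>For eigenvalues with sum 2 h and sum of squares 2 r^2, this is the square of
    half their difference.\<close>
  define c where "c = r^2 - h^2"
  have c: "c \<noteq> 0" using ne by (simp add: c_def)
  have A22: "A 2 2 q = 2 * h - A 1 1 q" if "q \<in> V" for q using trace[OF that] by simp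
  \<comment> \<open>The trace-free part of A moves on a circle of squared radius c.\<close>
  have ab: "(h - A 1 1 q) * (h - A 1 1 q) + A 1 2 q * A 1 2 q = c" if "q \<in> V" for q
  proof -
    have "2 * ((h - A 1 1 q) * (h - A 1 1 q) + A 1 2 q * A 1 2 q) = 2 * c"
      using norm[OF that] by (simp add: A22[OF that] c_def power2_eq_square algebra_simps)
    then show ?thesis by simp
  qed
  note S = smooth_on_add[OF open_V] smooth_on_mult[OF open_V] smooth_on_uminus[OF open_V]
    smooth_on_diff[OF open_V] smooth_on_const smooth_A smooth_D smooth_\<omega>
  have Dm: "D i (\<lambda>q. f q * g q) q = D i f q * g q + f q * D i g q"
    if "smooth_on f V" "smooth_on g V" "q \<in> V" for i q and f g :: "real^2 \<Rightarrow> real"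
    using D_mult[OF that] by simp
  have Da: "D i (\<lambda>q. h - A 1 1 q) q = - D i (A 1 1) q" if "q \<in> V" for i q
    using D_const_diff[OF that smooth_A] .
  have DA22: "D i (A 2 2) q = - D i (A 1 1) q" if "q \<in> V" for i q
  proof -
    have "D i (A 2 2) q = D i (\<lambda>q. 2 * h - A 1 1 q) q"
      by (rule D_cong[OF that A22 smooth_A])
    then show ?thesis
      using D_const_diff[OF that smooth_A] by simp
  qed
  have radial: "(h - A 1 1 q) * D i (A 1 1) q = A 1 2 q * D i (A 1 2) q" if "q \<in> V" for i q
  proof -
    have "D i (\<lambda>q. (h - A 1 1 q) * (h - A 1 1 q) + A 1 2 q * A 1 2 q) q = D i (\<lambda>q. c) q"
      by (rule D_cong[OF that], erule ab, intro S)
    then have "D i (\<lambda>q. (h - A 1 1 q) * (h - A 1 1 q) + A 1 2 q * A 1 2 q) q = 0"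
      by (simp add: D_const)
    moreover have "D i (\<lambda>q. (h - A 1 1 q) * (h - A 1 1 q) + A 1 2 q * A 1 2 q) q
        = D i (\<lambda>q. (h - A 1 1 q) * (h - A 1 1 q)) q + D i (\<lambda>q. A 1 2 q * A 1 2 q) q"
      using that by (intro D_add S)
    ultimately show ?thesis
      using that by (simp add: Dm S Da)
  qed
  \<comment> \<open>The Codazzi equations are linear in \<omega> with determinant a nonzero multiple
    of c. With a = h - A_11 and b = A_12 their solution is (a db - b da) / (2 c), half the
    differential of the angle of (a, b).\<close>
  have om: "\<omega> i q = (1 / (2 * c)) * (A 1 2 q * D i (A 1 1) q + (h - A 1 1 q) * D i (A 1 2) q)"
    if "q \<in> V" for i q
  proof -
    have "D 2 (A 1 1) q - D 1 (A 1 2) q = - 2 * \<omega> 1 q * (h - A 1 1 q) + 2 * \<omega> 2 q * A 1 2 q"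
      "D 2 (A 1 2) q + D 1 (A 1 1) q = 2 * \<omega> 1 q * A 1 2 q + 2 * \<omega> 2 q * (h - A 1 1 q)"
      using codazzi[OF that] by (simp_all add: A22 DA22 that algebra_simps)
    then have "2 * c * \<omega> 1 q = - (h - A 1 1 q) * (D 2 (A 1 1) q - D 1 (A 1 2) q) + A 1 2 q * (D 2 (A 1 2) q + D 1 (A 1 1) q)"
      "2 * c * \<omega> 2 q = A 1 2 q * (D 2 (A 1 1) q - D 1 (A 1 2) q) + (h - A 1 1 q) * (D 2 (A 1 2) q + D 1 (A 1 1) q)"
      unfolding ab[OF that, symmetric] by algebra+
    then have "2 * c * \<omega> 1 q = A 1 2 q * D 1 (A 1 1) q + (h - A 1 1 q) * D 1 (A 1 2) q"
      "2 * c * \<omega> 2 q = A 1 2 q * D 2 (A 1 1) q + (h - A 1 1 q) * D 2 (A 1 2) q"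
      using radial[OF that, of 1] radial[OF that, of 2] by (simp_all add: algebra_simps)
    then have "2 * c * \<omega> i q = A 1 2 q * D i (A 1 1) q + (h - A 1 1 q) * D i (A 1 2) q"
      using exhaust_2[of i] by auto
    then show ?thesis using c by (simp add: field_simps)
  qed
  have Dom: "D j (\<omega> i) p = (1 / (2 * c)) * (D j (A 1 2) p * D i (A 1 1) p + A 1 2 p * D j (D i (A 1 1)) p
      - D j (A 1 1) p * D i (A 1 2) p + (h - A 1 1 p) * D j (D i (A 1 2)) p)" for i j
  proof -
    have sm: "smooth_on (\<lambda>q. A 1 2 q * D i (A 1 1) q + (h - A 1 1 q) * D i (A 1 2) q) V"
      by (intro S)
    have "D j (\<omega> i) p = D j (\<lambda>q. (1 / (2 * c)) * (A 1 2 q * D i (A 1 1) q + (h - A 1 1 q) * D i (A 1 2) q)) p"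
      by (rule D_cong[OF p om smooth_\<omega>])
    also have "\<dots> = (1 / (2 * c)) * D j (\<lambda>q. A 1 2 q * D i (A 1 1) q + (h - A 1 1 q) * D i (A 1 2) q) p"
      using D_scaleR[OF p sm, of j "1 / (2 * c)"] unfolding real_scaleR_def .
    also have "D j (\<lambda>q. A 1 2 q * D i (A 1 1) q + (h - A 1 1 q) * D i (A 1 2) q) p
      = D j (\<lambda>q. A 1 2 q * D i (A 1 1) q) p + D j (\<lambda>q. (h - A 1 1 q) * D i (A 1 2) q) p"
      using p by (intro D_add S)
    finally show ?thesis by (simp add: Dm S Da p)
  qed
  define a b a1 a2 b1 b2 w1 w2 where "a = h - A 1 1 p" and "b = A 1 2 p" and "a1 = D 1 (A 1 1) p"
    and "a2 = D 2 (A 1 1) p" and "b1 = D 1 (A 1 2) p" and "b2 = D 2 (A 1 2) p"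
    and "w1 = \<omega> 1 p" and "w2 = \<omega> 2 p"
  note defs = this
  have 1: "D 1 (D 2 (A 1 1)) p = D 2 (D 1 (A 1 1)) p - w1 * a1 - w2 * a2"
    "D 1 (D 2 (A 1 2)) p = D 2 (D 1 (A 1 2)) p - w1 * b1 - w2 * b2"
    using commutator[OF p smooth_A[of 1 1]] commutator[OF p smooth_A[of 1 2]] by (simp_all add: defs)
  have w: "2 * c * w1 = b * a1 + a * b1" "2 * c * w2 = b * a2 + a * b2"
    using om[OF p, of 1] om[OF p, of 2] c by (simp_all add: defs field_simps)
  have r12: "a * a1 = b * b1" "a * a2 = b * b2" and abc: "a * a + b * b = c"
    using radial[OF p] ab[OF p] by (simp_all add: defs)
  \<comment> \<open>The differentials of a and b are parallel because (a, b) stays on a circle. The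
    factor c = a a + b b avoids deciding which of a, b is nonzero.\<close>
  have "c * (b1 * a2 - a1 * b2) = 0"
    unfolding abc[symmetric] using r12 by algebra
  then have dd: "b1 * a2 = a1 * b2" using c by simp
  \<comment> \<open>Closedness of \<omega> in a frame that does not commute: the bracket accounts
    for the right side -(w1 w1 + w2 w2) reached below, which makes the left side of
    \<open>gauss\<close> vanish.\<close>
  have "D 1 (\<omega> 2) p - D 2 (\<omega> 1) p = (1 / (2 * c)) * (2 * (b1 * a2 - a1 * b2)
      + b * (- w1 * a1 - w2 * a2) + a * (- w1 * b1 - w2 * b2))"
    unfolding Dom 1 by (simp add: defs algebra_simps)
  also have "\<dots> = (1 / (2 * c)) * (- w1 * (b * a1 + a * b1) - w2 * (b * a2 + a * b2))"
    unfolding dd by (simp add: algebra_simps)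
  also have "\<dots> = - (w1 * w1) - w2 * w2"
    unfolding w[symmetric] using c by (simp add: field_simps)
  finally have "A 1 1 p * A 2 2 p - A 1 2 p * A 1 2 p = r^2"
    using gauss[OF p] eps by (auto simp: defs)
  \<comment> \<open>Thus the determinant is h^2 - c; equal to r^2 = h^2 + c, it forces c =
    0.\<close>
  moreover have "A 1 1 p * A 2 2 p - A 1 2 p * A 1 2 p = h * h - (a * a + b * b)"
    by (simp add: A22[OF p] defs algebra_simps)
  ultimately show False
    using c abc by (simp add: c_def power2_eq_square)
qed

lemma harmonic_null_hyperplane:
  assumes "convex V" "V \<noteq> {}"
    and harm: "\<And>p. p \<in> V \<Longrightarrow> laplacian x E (\<lambda>q. wedge (\<xi> q) (N q)) p = 0"
  obtains k where "lorentz k k = 0" "k \<noteq> 0" "\<And>p. p \<in> V \<Longrightarrow> lorentz (x p) k = \<epsilon> / r"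
proof -
  obtain t where t: "\<And>p. p \<in> V \<Longrightarrow> A 1 1 p + A 2 2 p = t"
  proof (rule D_zero_constant[OF assms(1), of "\<lambda>p. A 1 1 p + A 2 2 p"])
    show "smooth_on (\<lambda>p. A 1 1 p + A 2 2 p) V"
      by (rule smooth_on_add[OF open_V smooth_A smooth_A])
  qed (simp_all add: D_add[OF smooth_A smooth_A] harmonic_equations harm)
  define h where "h = t / 2"
  have trace: "A 1 1 q + A 2 2 q = 2 * h" if "q \<in> V" for q using t[OF that] by (simp add: h_def)
  have norm: "A 1 1 q * A 1 1 q + 2 * (A 1 2 q * A 1 2 q) + A 2 2 q * A 2 2 q = 2 * r^2" if "q \<in> V" for q
    using harmonic_equations(3)[OF that harm[OF that]] .
  obtain p0 where p0: "p0 \<in> V" using assms(2) by blast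
  have h: "h^2 = r^2" by (rule constant_shape_umbilic[OF p0 trace norm])
  have umb: "A 1 1 p = h" "A 2 2 p = h" "A 1 2 p = 0" if "p \<in> V" for p
  proof -
    have A22: "A 2 2 p = 2 * h - A 1 1 p" using trace[OF that] by simp
    \<comment> \<open>The circle of trace-free parts has shrunk to a point, since r^2 - h^2 =
      0.\<close>
    have "(A 1 1 p - h) * (A 1 1 p - h) + A 1 2 p * A 1 2 p = 0"
      using norm[OF that, unfolded A22] h by algebra
    then have "A 1 1 p - h = 0 \<and> A 1 2 p = 0" by (simp only: sum_squares_eq_zero_iff)
    then show "A 1 1 p = h" "A 2 2 p = h" "A 1 2 p = 0" by (simp_all add: A22)
  qed
  have DN': "D i N p = - h *\<^sub>R e i p" if "p \<in> V" for i p
    using expansion[OF that, of "D i N p"] exhaust_2[of i] that by (auto simp: DN umb A_sym)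
  have Dx: "D i x p = e i p" for i p by (simp add: D_def e_def)
  have sm: "smooth_on (\<lambda>p. h *\<^sub>R x p) V"
    by (intro smooth_on_scaleR open_V smooth_on_const smooth_x)
  have "D i (\<lambda>p. N p + h *\<^sub>R x p) p = 0" if "p \<in> V" for i p
    using that by (simp add: D_add[OF smooth_N sm] D_scaleR smooth_x DN' Dx)
  then obtain w where w: "\<And>p. p \<in> V \<Longrightarrow> N p + h *\<^sub>R x p = w"
    using D_zero_constant[OF assms(1) smooth_on_add[OF open_V smooth_N sm]] by blast
  have hr: "h * h = r * r" "h \<noteq> 0" using h r_pos by (auto simp: power2_eq_square)
  have xN: "lorentz (x p) (N p) = 0" if "p \<in> V" for p
    using N_orth(2)[OF that] r_pos by (simp add: \<xi>_def lorentz_simps)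
  have xw: "lorentz (x p) w = h * \<epsilon> / r^2" if "p \<in> V" for p
    using w[OF that, symmetric] that by (simp add: lorentz_simps xN quadric)
  have "lorentz w w = - \<epsilon> + h * h * (\<epsilon> / r^2)"
    unfolding w[OF p0, symmetric] using p0
    by (simp add: lorentz_simps lorentz_commute[of "N p0" "x p0"] xN quadric N_orth)
  then have "lorentz w w = 0" using hr r_pos by (simp add: power2_eq_square)
  show thesis
  \<comment> \<open>The factor r / h is 1 or -1. It absorbs the sign of the eigenvalue, which
    depends on the orientation, so the level of the hyperplane is always \<epsilon> / r.\<close>
  proof (rule that[of "(r / h) *\<^sub>R w"])
    show "lorentz ((r / h) *\<^sub>R w) ((r / h) *\<^sub>R w) = 0"
      using \<open>lorentz w w = 0\<close> by (simp add: lorentz_simps)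
    show xk: "lorentz (x p) ((r / h) *\<^sub>R w) = \<epsilon> / r" if "p \<in> V" for p
      using hr r_pos by (simp add: lorentz_simps xw[OF that] power2_eq_square)
    show "(r / h) *\<^sub>R w \<noteq> 0"
    proof
      assume "(r / h) *\<^sub>R w = 0"
      then show False using xk[OF p0] eps r_pos by (auto simp: lorentz_simps)
    qed
  qed
qed

end

section \<open>The model surfaces\<close>

definition null_vector :: "real^4" where "null_vector = vector [1, 0, 0, 1]"

text \<open>The constants (1 - \<epsilon>) / (2 r) and (1 + \<epsilon>) / (2 r) switch between 0 and
  1 / r, so that both displayed surfaces are instances.\<close>

definition paraboloid :: "real \<Rightarrow> real \<Rightarrow> real^2 \<Rightarrow> real^4" where
  "paraboloid \<epsilon> r p = vector [(1 - \<epsilon>) / (2 * r) + r/2 * ((p$1)^2 + (p$2)^2), p$1, p$2,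
     r/2 * ((p$1)^2 + (p$2)^2) - (1 + \<epsilon>) / (2 * r)]"

lemma paraboloid_surf: "surf_S31 r = paraboloid 1 r" "surf_H3 r = paraboloid (-1) r"
  by (simp_all add: fun_eq_iff surf_S31_def surf_H3_def paraboloid_def Let_def)

text \<open>The hyperplane condition is y_1 - y_4 = 1 / r. Since <y,y> is y_2^2 + y_3^2 - (y_1 -
  y_4)(y_1 + y_4), the quadric equation then becomes linear in y_1 + y_4, and the whole section is a
  graph over (y_2, y_3).\<close>

lemma paraboloid_iff:
  assumes "r > 0" "\<epsilon> = 1 \<or> \<epsilon> = -1"
  shows "y = paraboloid \<epsilon> r (vector [y$2, y$3]) \<longleftrightarrow>
    lorentz y y = \<epsilon> / r^2 \<and> lorentz y (- \<epsilon> *\<^sub>R null_vector) = \<epsilon> / r"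
proof -
  have eq: "lorentz y (- \<epsilon> *\<^sub>R null_vector) = \<epsilon> * (y$1 - y$4)"
    by (simp add: lorentz_def null_vector_def algebra_simps)
  have "y = paraboloid \<epsilon> r (vector [y$2, y$3]) \<longleftrightarrow>
    y$1 = (1 - \<epsilon>) / (2 * r) + r/2 * ((y$2)^2 + (y$3)^2) \<and> y$4 = r/2 * ((y$2)^2 + (y$3)^2) - (1 + \<epsilon>) / (2 * r)"
    by (simp add: vec_eq_iff forall_4 paraboloid_def)
  also have "\<dots> \<longleftrightarrow> y$1 - y$4 = 1 / r \<and> y$1 + y$4 = r * ((y$2)^2 + (y$3)^2) - \<epsilon> / r"
    using assms(1) by (auto simp: field_simps)
  also have "\<dots> \<longleftrightarrow> y$1 - y$4 = 1 / r \<and> lorentz y y = \<epsilon> / r^2"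
  proof -
    have "lorentz y y = \<epsilon> / r^2 \<longleftrightarrow> y$1 + y$4 = r * ((y$2)^2 + (y$3)^2) - \<epsilon> / r" if "y$1 - y$4 = 1 / r"
    proof -
      have "lorentz y y = (y$2)^2 + (y$3)^2 - (y$1 - y$4) * (y$1 + y$4)"
        by (simp add: lorentz_def power2_eq_square algebra_simps)
      then have "r * lorentz y y = r * ((y$2)^2 + (y$3)^2 - (1 / r) * (y$1 + y$4))"
        unfolding that by simp
      also have "\<dots> = r * ((y$2)^2 + (y$3)^2) - (y$1 + y$4)"
        using assms(1) by (simp add: right_diff_distrib)
      finally have l: "r * lorentz y y = r * ((y$2)^2 + (y$3)^2) - (y$1 + y$4)" .
      have "lorentz y y = \<epsilon> / r^2 \<longleftrightarrow> r * lorentz y y = \<epsilon> / r"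
        using assms(1) by (auto simp: field_simps power2_eq_square)
      then show ?thesis unfolding l by auto
    qed
    then show ?thesis by blast
  qed
  finally show ?thesis
    using assms unfolding eq by (auto simp: field_simps)
qed

definition paraboloid_deriv :: "real \<Rightarrow> real^2 \<Rightarrow> real^2 \<Rightarrow> real^4" where
  "paraboloid_deriv r p v = (r * (p \<bullet> v)) *\<^sub>R null_vector + v$1 *\<^sub>R axis 2 1 + v$2 *\<^sub>R axis 3 1"

lemma paraboloid_alt:
  "paraboloid \<epsilon> r p = vector [(1 - \<epsilon>) / (2 * r), 0, 0, - ((1 + \<epsilon>) / (2 * r))]
    + (r / 2 * (p \<bullet> p)) *\<^sub>R null_vector + p$1 *\<^sub>R axis 2 1 + p$2 *\<^sub>R axis 3 1"
  by (simp add: vec_eq_iff forall_4 paraboloid_def null_vector_def axis_def inner_vec_def sum_2 power2_eq_square)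

lemma has_derivative_paraboloid: "(paraboloid \<epsilon> r has_derivative paraboloid_deriv r p) (at p)"
proof -
  have nth: "((\<lambda>q. q $ i) has_derivative (\<lambda>v. v $ i)) (at p)" for i :: 2
    by (rule bounded_linear_imp_has_derivative[OF bounded_linear_vec_nth])
  show ?thesis
    unfolding paraboloid_alt[abs_def] paraboloid_deriv_def[abs_def]
    by (auto intro!: derivative_eq_intros nth simp: inner_commute algebra_simps)
qed

lemma frechet_derivative_paraboloid: "frechet_derivative (paraboloid \<epsilon> r) (at p) = paraboloid_deriv r p"
  using frechet_derivative_at[OF has_derivative_paraboloid] by simp

lemma smooth_on_paraboloid: "smooth_on (paraboloid \<epsilon> r) UNIV"
  unfolding paraboloid_alt[abs_def]
  by (intro smooth_on_add smooth_on_scaleR smooth_on_mult smooth_on_const smooth_on_vec_nth smooth_on_id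
      smooth_on_bilinear[OF bounded_bilinear_inner] open_UNIV)

lemma lorentz_null_vector: "lorentz null_vector null_vector = 0"
  "lorentz null_vector (axis 2 1) = 0" "lorentz null_vector (axis 3 1) = 0"
  "lorentz (axis 2 1) null_vector = 0" "lorentz (axis 3 1) null_vector = 0"
  by (simp_all add: lorentz_def null_vector_def axis_def)

lemma lorentz_axis: "lorentz (axis 2 1) (axis 2 1) = 1" "lorentz (axis 2 1) (axis 3 1) = 0"
  "lorentz (axis 3 1) (axis 2 1) = 0" "lorentz (axis 3 1) (axis 3 1) = 1"
  by (simp_all add: lorentz_def axis_def)

text \<open>The null vector is orthogonal to itself and to both axes, so the quadratic part
  contributes nothing: (u, v) are flat coordinates.\<close>

lemma lorentz_paraboloid_deriv: "lorentz (paraboloid_deriv r p v) (paraboloid_deriv r p w) = v \<bullet> w"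
  by (simp add: paraboloid_deriv_def lorentz_simps lorentz_null_vector lorentz_axis inner_vec_def sum_2)

lemma lorentz_null_vector_deriv: "lorentz null_vector (paraboloid_deriv r p w) = 0"
  by (simp add: paraboloid_deriv_def lorentz_simps lorentz_null_vector)

lemma spacelike_paraboloid: "spacelike_surface euclidean plane_atlas (paraboloid \<epsilon> r)"
proof -
  have countable: "second_countable (euclidean :: (real^2) topology)"
  proof -
    obtain B :: "(real^2) set set" where B: "countable B" "topological_basis B"
      using ex_countable_basis by blast
    have "\<exists>V\<in>B. x \<in> V \<and> V \<subseteq> U" if "open U" "x \<in> U" for U x
      by (rule topological_basisE[OF B(2) that]) blast
    then show ?thesis
      unfolding second_countable_def
      using B(1) topological_basis_open[OF B(2)] by (intro exI[of _ B] conjI ballI allI impI) simp_all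
  qed
  have sm: "smooth_on (id :: real^2 \<Rightarrow> real^2) UNIV"
    using smooth_on_id unfolding id_def .
  have jac: "jacobian (id :: real^2 \<Rightarrow> real^2) (at p) = mat 1" for p
    by (simp add: jacobian_def matrix_id_mat_1)
  have emb: "embedding_map euclidean euclidean (id :: real^2 \<Rightarrow> real^2)"
    by (simp add: embedding_map_def homeomorphic_map_id)
  have "oriented_surface euclidean plane_atlas"
    unfolding oriented_surface_def plane_atlas_def Let_def
    using countable sm emb by (simp add: jac)
  moreover have "spacelike_immersion plane_atlas (paraboloid \<epsilon> r)"
  proof -
    interpret bounded_linear "paraboloid_deriv r p" for p
      using has_derivative_paraboloid has_derivative_bounded_linear by blast
    have ker: "v = 0" if "paraboloid_deriv r p v = 0" for p v
    proof -
      have "v \<bullet> v = 0"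
        using lorentz_paraboloid_deriv[of r p v v] unfolding that by (simp add: lorentz_simps)
      then show "v = 0" by simp
    qed
    then have "inj (paraboloid_deriv r p)" for p
      using linear_injective_0[OF linear_axioms] by blast
    moreover have "lorentz (paraboloid_deriv r p v) (paraboloid_deriv r p v) > 0"
      if "paraboloid_deriv r p v \<noteq> 0" for p v
    proof -
      have "v \<noteq> 0" using that zero by metis
      then show ?thesis by (simp add: lorentz_paraboloid_deriv)
    qed
    ultimately show ?thesis
      unfolding spacelike_immersion_def plane_atlas_def
      by (simp add: frechet_derivative_paraboloid smooth_on_paraboloid Let_def)
  qed
  ultimately show ?thesis by (simp add: spacelike_surface_def)
qed

lemma gauss_map_paraboloid:
  assumes "r > 0" "\<epsilon> = 1 \<or> \<epsilon> = -1"
  shows "gauss_map plane_atlas (paraboloid \<epsilon> r) p = r *\<^sub>R wedge (paraboloid \<epsilon> r p) null_vector"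
proof -
  \<comment> \<open>N is the null vector made orthogonal to \<xi>: their product is -1 and \<xi> has
    square \<epsilon>. The added multiple of \<xi> disappears in \<xi> \<and> N.\<close>
  define e1 e2 \<xi> N where "e1 = paraboloid_deriv r p (axis 1 1)" and "e2 = paraboloid_deriv r p (axis 2 1)"
    and "\<xi> = r *\<^sub>R paraboloid \<epsilon> r p" and "N = null_vector + \<epsilon> *\<^sub>R \<xi>"
  define e :: "4 \<Rightarrow> real^4" where
    "e = (\<lambda>i. if i = 1 then e1 else if i = 2 then e2 else if i = 3 then \<xi> else N)"
  have e: "e 1 = e1" "e 2 = e2" "e 3 = \<xi>" "e 4 = N" by (simp_all add: e_def)
  have "paraboloid \<epsilon> r p = paraboloid \<epsilon> r (vector [paraboloid \<epsilon> r p $ 2, paraboloid \<epsilon> r p $ 3])"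
    by (simp add: paraboloid_def)
  then have q: "lorentz (paraboloid \<epsilon> r p) (paraboloid \<epsilon> r p) = \<epsilon> / r^2"
    "lorentz (paraboloid \<epsilon> r p) (- \<epsilon> *\<^sub>R null_vector) = \<epsilon> / r"
    using paraboloid_iff[OF assms] by blast+
  have xn: "lorentz (paraboloid \<epsilon> r p) null_vector = - 1 / r"
    using q(2) assms(2) by (auto simp: lorentz_simps)
  then have xi: "lorentz \<xi> \<xi> = \<epsilon>" "lorentz \<xi> null_vector = - 1" "lorentz null_vector \<xi> = - 1"
    using q(1) assms(1) by (simp_all add: \<xi>_def lorentz_simps power2_eq_square lorentz_commute)
  have en: "lorentz null_vector e1 = 0" "lorentz null_vector e2 = 0"
    by (simp_all add: e1_def e2_def lorentz_null_vector_deriv)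
  have "lorentz (paraboloid \<epsilon> r p) (paraboloid_deriv r p v) = 0" for v
  proof -
    have "lorentz (paraboloid \<epsilon> r p) (axis 2 1) = p$1" "lorentz (paraboloid \<epsilon> r p) (axis 3 1) = p$2"
      by (simp_all add: lorentz_def paraboloid_def axis_def)
    then show ?thesis
      using assms(1) by (simp add: paraboloid_deriv_def lorentz_simps xn inner_vec_def sum_2)
  qed
  then have ex: "lorentz \<xi> e1 = 0" "lorentz \<xi> e2 = 0"
    by (simp_all add: e1_def e2_def \<xi>_def lorentz_simps)
  have ee: "lorentz e1 e1 = 1" "lorentz e1 e2 = 0" "lorentz e2 e2 = 1"
    by (simp_all add: e1_def e2_def lorentz_paraboloid_deriv inner_axis_axis)
  have N: "lorentz N N = - \<epsilon>" "lorentz N e1 = 0" "lorentz N e2 = 0" "lorentz N \<xi> = 0"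
    using assms(2) by (auto simp: N_def lorentz_simps en ex xi lorentz_null_vector)
  have sym: "lorentz e2 e1 = 0" "lorentz e1 \<xi> = 0" "lorentz e2 \<xi> = 0"
    "lorentz e1 N = 0" "lorentz e2 N = 0" "lorentz \<xi> N = 0"
    using ee(2) ex N(2-4) by (simp_all add: lorentz_commute)
  have "orthonormal_frame e"
    unfolding orthonormal_frame_def forall_4 e
    using assms(2) by (auto simp: N ee ex xi(1) sym)
  moreover have "det (\<chi> i. e i) = 1"
  proof -
    define S u v where "S = r^2 / 2 * ((p$1)^2 + (p$2)^2)" and "u = r * p$1" and "v = r * p$2"
    have "e1 $ 1 = u" "e1 $ 2 = 1" "e1 $ 3 = 0" "e1 $ 4 = u"
      "e2 $ 1 = v" "e2 $ 2 = 0" "e2 $ 3 = 1" "e2 $ 4 = v"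
      by (simp_all add: e1_def e2_def u_def v_def paraboloid_deriv_def null_vector_def axis_def inner_vec_def sum_2)
    moreover have "\<xi> $ 1 = (1 - \<epsilon>) / 2 + S" "\<xi> $ 2 = u" "\<xi> $ 3 = v" "\<xi> $ 4 = S - (1 + \<epsilon>) / 2"
      using assms(1) by (simp_all add: \<xi>_def S_def u_def v_def paraboloid_def power2_eq_square field_simps)
    moreover have "N $ 1 = 1 + \<epsilon> * \<xi> $ 1" "N $ 2 = \<epsilon> * \<xi> $ 2" "N $ 3 = \<epsilon> * \<xi> $ 3" "N $ 4 = 1 + \<epsilon> * \<xi> $ 4"
      by (simp_all add: N_def null_vector_def)
    ultimately show ?thesis
      by (simp only: det_4 e vec_lambda_beta) (simp add: field_simps)
  qed
  moreover have "det (vector [axis 1 1, axis 2 1] :: real^2^2) > 0"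
    by (simp add: det_2 axis_def)
  moreover have "frechet_derivative (paraboloid \<epsilon> r \<circ> id) (at p) = paraboloid_deriv r p"
    by (simp add: frechet_derivative_paraboloid)
  ultimately have "gauss_map plane_atlas (paraboloid \<epsilon> r) (id p) = wedge (e 3) (e 4)"
    by (intro gauss_map_eq[OF spacelike_paraboloid, where U = UNIV and \<psi> = id])
      (simp_all add: plane_atlas_def e e1_def e2_def)
  then show ?thesis by (simp add: e N_def \<xi>_def wedge_simps)
qed

text \<open>The induced metric is flat, and since the quadratic part of the parametrization is a multiple of
  the null vector, the Gauss map is an affine function of the flat coordinates.\<close>

lemma harmonic_paraboloid:
  assumes "r > 0" "\<epsilon> = 1 \<or> \<epsilon> = -1"
  shows "harmonic_map plane_atlas (paraboloid \<epsilon> r) (gauss_map plane_atlas (paraboloid \<epsilon> r))"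
proof -
  let ?x = "paraboloid \<epsilon> r" and ?\<nu> = "gauss_map plane_atlas (paraboloid \<epsilon> r)"
  define F where "F v = r *\<^sub>R wedge (v$1 *\<^sub>R axis 2 1 + v$2 *\<^sub>R axis 3 1) null_vector" for v :: "real^2"
  have "linear F"
    by (rule linearI) (simp_all add: F_def wedge_simps algebra_simps)
  then have F: "bounded_linear F" by (simp add: linear_conv_bounded_linear)
  have \<nu>: "?\<nu> = (\<lambda>p. r *\<^sub>R wedge (vector [(1 - \<epsilon>) / (2 * r), 0, 0, - ((1 + \<epsilon>) / (2 * r))]) null_vector + F p)"
    by (simp add: fun_eq_iff gauss_map_paraboloid[OF assms] paraboloid_alt F_def wedge_simps algebra_simps)
  have d\<nu>: "vf_deriv X ?\<nu> = (\<lambda>p. F (X p))" for X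
  proof
    fix p
    have "(?\<nu> has_derivative F) (at p)"
      unfolding \<nu> by (auto intro!: derivative_eq_intros bounded_linear_imp_has_derivative[OF F])
    then show "vf_deriv X ?\<nu> p = F (X p)" by (rule vf_deriv_eqI)
  qed
  \<comment> \<open>In flat coordinates covariant differentiation is componentwise: the extra
    second-derivative term is a multiple of the null vector, which is orthogonal to the tangent
    plane. The two terms of each summand of the Laplacian then agree.\<close>
  have lc: "levi_civita ?x X Y p = vf_deriv X Y p"
    if "smooth_on Y V" "p \<in> V" for X Y p V
  proof -
    have Y: "(Y has_derivative frechet_derivative Y (at p)) (at p)"
      using smooth_on_has_derivative[OF that] .
    have nth: "((\<lambda>q. Y q $ i) has_derivative (\<lambda>v. frechet_derivative Y (at p) v $ i)) (at p)" for i :: 2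
      using bounded_linear.has_derivative[OF bounded_linear_vec_nth Y] .
    have "vf_deriv Y ?x = (\<lambda>q. (r * (q \<bullet> Y q)) *\<^sub>R null_vector + Y q $ 1 *\<^sub>R axis 2 1 + Y q $ 2 *\<^sub>R axis 3 1)"
      by (simp add: fun_eq_iff vf_deriv_def frechet_derivative_paraboloid paraboloid_deriv_def)
    moreover have "((\<lambda>q. (r * (q \<bullet> Y q)) *\<^sub>R null_vector + Y q $ 1 *\<^sub>R axis 2 1 + Y q $ 2 *\<^sub>R axis 3 1)
      has_derivative (\<lambda>v. (r * (p \<bullet> frechet_derivative Y (at p) v + v \<bullet> Y p)) *\<^sub>R null_vector
        + frechet_derivative Y (at p) v $ 1 *\<^sub>R axis 2 1 + frechet_derivative Y (at p) v $ 2 *\<^sub>R axis 3 1)) (at p)"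
      by (auto intro!: derivative_eq_intros nth Y)
    ultimately have "vf_deriv X (vf_deriv Y ?x) p = (r * (p \<bullet> vf_deriv X Y p + X p \<bullet> Y p)) *\<^sub>R null_vector
        + vf_deriv X Y p $ 1 *\<^sub>R axis 2 1 + vf_deriv X Y p $ 2 *\<^sub>R axis 3 1"
      using vf_deriv_eqI[of "vf_deriv Y ?x" _ p X] by (simp add: vf_deriv_def)
    then have "vf_deriv X (vf_deriv Y ?x) p = (r * (X p \<bullet> Y p)) *\<^sub>R null_vector + paraboloid_deriv r p (vf_deriv X Y p)"
      by (simp add: paraboloid_deriv_def algebra_simps)
    then have eq: "lorentz (vf_deriv X (vf_deriv Y ?x) p) (paraboloid_deriv r p w) = vf_deriv X Y p \<bullet> w" for w
      by (simp add: lorentz_simps lorentz_null_vector_deriv lorentz_paraboloid_deriv)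
    show ?thesis
      unfolding levi_civita_def frechet_derivative_paraboloid eq lorentz_paraboloid_deriv
      by (rule the_equality) (auto simp: vector_eq_rdot)
  qed
  have "laplacian ?x E ?\<nu> p = 0" if "tangent_frame ?x V E" "p \<in> V" for V E p
  proof -
    have E: "smooth_on (E i) V" for i using that(1) by (simp add: tangent_frame_def)
    have "vf_deriv (E i) (vf_deriv (E i) ?\<nu>) p = F (vf_deriv (E i) (E i) p)" for i
      unfolding d\<nu>
      using vf_deriv_eqI[OF bounded_linear.has_derivative[OF F smooth_on_has_derivative[OF E that(2)]]]
      by (simp add: vf_deriv_def)
    then show ?thesis
      by (simp add: laplacian_def d\<nu> lc[OF E that(2)])
  qed
  then show ?thesis
    by (simp add: harmonic_map_def plane_atlas_def)
qed

section \<open>Local congruence\<close>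

lemma gram_schmidt_frame:
  assumes "open V" "smooth_on x V"
    and inj: "\<And>p. p \<in> V \<Longrightarrow> inj (frechet_derivative x (at p))"
    and pos: "\<And>p w. p \<in> V \<Longrightarrow> w \<in> range (frechet_derivative x (at p)) \<Longrightarrow> w \<noteq> 0 \<Longrightarrow> lorentz w w > 0"
  obtains E where "tangent_frame x V E" "\<forall>p\<in>V. det (vector [E 1 p, E 2 p] :: real^2^2) > 0"
proof -
  define a where "a i p = frechet_derivative x (at p) (axis i 1)" for i :: 2 and p
  define g where "g i j p = lorentz (a i p) (a j p)" for i j p
  \<comment> \<open>A positive multiple of the Gram-Schmidt projection, cleared of denominators;
    \<open>h\<close> is the square of its image, so only inverse square roots are left to
    treat.\<close>
  define v where "v p = g 1 1 p *\<^sub>R axis 2 1 - g 1 2 p *\<^sub>R (axis 1 1 :: real^2)" for p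
  define h where "h p = g 1 1 p * (g 1 1 p * g 2 2 p - g 1 2 p * g 1 2 p)" for p
  define E where "E i p = (if i = 1 then (1 / sqrt (g 1 1 p)) *\<^sub>R axis 1 1 else (1 / sqrt (h p)) *\<^sub>R v p)"
    for i :: 2 and p
  have lorentz_pos: "lorentz (frechet_derivative x (at p) w) (frechet_derivative x (at p) w) > 0"
    if "p \<in> V" "w \<noteq> 0" for p w
  proof -
    have "frechet_derivative x (at p) w \<noteq> frechet_derivative x (at p) 0"
      using inj[OF that(1)] that(2) by (simp add: inj_eq)
    moreover have "frechet_derivative x (at p) 0 = 0"
      using smooth_on_bounded_linear_deriv[OF assms(2) that(1)] linear_0 bounded_linear.linear by blast
    ultimately show ?thesis using pos[OF that(1)] by simp
  qed
  have g11: "g 1 1 p > 0" if "p \<in> V" for p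
    using lorentz_pos[OF that, of "axis 1 1"] by (simp add: g_def a_def axis_eq_0_iff)
  have dv: "frechet_derivative x (at p) (v p) = g 1 1 p *\<^sub>R a 2 p - g 1 2 p *\<^sub>R a 1 p" if "p \<in> V" for p
  proof -
    interpret bounded_linear "frechet_derivative x (at p)"
      using smooth_on_bounded_linear_deriv[OF assms(2) that] .
    show ?thesis by (simp add: v_def a_def diff scaleR)
  qed
  have sym: "g 2 1 p = g 1 2 p" for p by (simp add: g_def lorentz_commute)
  have hv: "h p = lorentz (frechet_derivative x (at p) (v p)) (frechet_derivative x (at p) (v p))" if "p \<in> V" for p
    using sym[of p] by (simp add: dv[OF that] lorentz_simps h_def algebra_simps flip: g_def)
  have h: "h p > 0" if "p \<in> V" for p
  proof -
    have "v p $ 2 \<noteq> 0" using g11[OF that] by (simp add: v_def axis_def)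
    then have "v p \<noteq> 0" by (metis zero_index)
    then show ?thesis using lorentz_pos[OF that] hv[OF that] by simp
  qed
  have sa: "smooth_on (a i) V" for i
    unfolding a_def by (rule smooth_on_deriv[OF assms(2)])
  have sg: "smooth_on (g i j) V" for i j
    unfolding g_def by (intro smooth_on_bilinear[OF bounded_bilinear_lorentz assms(1)] sa)
  have sh: "smooth_on h V"
    unfolding h_def by (intro smooth_on_mult smooth_on_diff assms(1) sg)
  have "smooth_on (E 1) V" "smooth_on (E 2) V"
    unfolding E_def v_def using g11 h
    by (simp_all, intro smooth_on_scaleR smooth_on_diff smooth_on_const smooth_on_inverse_sqrt assms(1) sg sh; simp)+
  then have sE: "smooth_on (E i) V" for i using exhaust_2[of i] by auto
  have "lorentz (vf_deriv (E i) x p) (vf_deriv (E j) x p) = (if i = j then 1 else 0)" if "p \<in> V" for i j p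
  proof -
    interpret bounded_linear "frechet_derivative x (at p)"
      using smooth_on_bounded_linear_deriv[OF assms(2) that] .
    have e1: "vf_deriv (E 1) x p = (1 / sqrt (g 1 1 p)) *\<^sub>R a 1 p"
      by (simp add: vf_deriv_def E_def scaleR a_def)
    have e2: "vf_deriv (E 2) x p = (1 / sqrt (h p)) *\<^sub>R frechet_derivative x (at p) (v p)"
      by (simp add: vf_deriv_def E_def scaleR)
    have "lorentz (a 1 p) (frechet_derivative x (at p) (v p)) = 0"
      by (simp add: dv[OF that] lorentz_simps flip: g_def)
    moreover have "lorentz (a 1 p) (a 1 p) = g 1 1 p" by (simp add: g_def)
    ultimately have "lorentz (vf_deriv (E 1) x p) (vf_deriv (E 1) x p) = 1"
      "lorentz (vf_deriv (E 2) x p) (vf_deriv (E 2) x p) = 1"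
      "lorentz (vf_deriv (E 1) x p) (vf_deriv (E 2) x p) = 0"
      using g11[OF that] h[OF that] by (simp_all add: e1 e2 lorentz_simps hv[OF that, symmetric])
    then show ?thesis using exhaust_2[of i] exhaust_2[of j] by (auto simp: lorentz_commute)
  qed
  then have "tangent_frame x V E"
    using assms(1) sE by (simp add: tangent_frame_def)
  moreover have "\<forall>p\<in>V. det (vector [E 1 p, E 2 p] :: real^2^2) > 0"
    using g11 h by (simp add: det_2 E_def v_def axis_def)
  ultimately show thesis by (rule that)
qed

text \<open>Connects the abstract surface with the moving frame. Positive orientation of the frame
  matters here: it identifies the Gauss map with \<xi> \<and> N rather than its negative.\<close>

lemma harmonic_patch:
  assumes r: "r > 0" and eps: "\<epsilon> = 1 \<or> \<epsilon> = -1"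
    and surf: "spacelike_surface M A f" and chart: "(U, \<psi>) \<in> A"
    and quadric: "\<And>p. p \<in> U \<Longrightarrow> lorentz (f (\<psi> p)) (f (\<psi> p)) = \<epsilon> / r^2"
    and harm: "harmonic_map A f (gauss_map A f)"
    and V: "V \<subseteq> U" "open V" "convex V" "V \<noteq> {}"
  obtains k where "lorentz k k = 0" "k \<noteq> 0" "\<And>p. p \<in> V \<Longrightarrow> lorentz (f (\<psi> p)) k = \<epsilon> / r"
proof -
  define x where "x = f \<circ> \<psi>"
  have im: "spacelike_immersion A f" using surf by (simp add: spacelike_surface_def)
  have "smooth_on x U" and reg: "\<And>p. p \<in> U \<Longrightarrow> inj (frechet_derivative x (at p)) \<and>
      (\<forall>w\<in>range (frechet_derivative x (at p)). w \<noteq> 0 \<longrightarrow> lorentz w w > 0)"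
    using im chart unfolding spacelike_immersion_def Let_def x_def by blast+
  then have x: "smooth_on x V" using V(1) smooth_on_subset by blast
  have inj: "inj (frechet_derivative x (at p))"
    and pos: "\<And>w. w \<in> range (frechet_derivative x (at p)) \<Longrightarrow> w \<noteq> 0 \<Longrightarrow> lorentz w w > 0"
    if "p \<in> V" for p
    using reg[of p] that V(1) by blast+
  obtain E where E: "tangent_frame x V E" and "\<forall>p\<in>V. det (vector [E 1 p, E 2 p] :: real^2^2) > 0"
    using gram_schmidt_frame[OF V(2) x inj pos] .
  then have orient: "det (vector [E 1 p, E 2 p] :: real^2^2) > 0" if "p \<in> V" for p
    using that by blast
  interpret framed_patch x V E r \<epsilon>
  proof
    show "lorentz (x p) (x p) = \<epsilon> / r^2" if "p \<in> V" for p
      using quadric[of p] that V(1) by (auto simp: x_def)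
    show "det (vector [E 1 p, E 2 p] :: real^2^2) \<noteq> 0" if "p \<in> V" for p
      using orient[OF that] by simp
  qed (use E x r eps in auto)
  have nu: "gauss_map A f (\<psi> p) = wedge (\<xi> p) (N p)" if "p \<in> V" for p
    unfolding N_def
  proof (rule gauss_map_quadric[OF surf chart _ orient[OF that]])
    show "p \<in> U" using that V(1) by blast
    show "e 1 p = frechet_derivative (f \<circ> \<psi>) (at p) (E 1 p)" "e 2 p = frechet_derivative (f \<circ> \<psi>) (at p) (E 2 p)"
      unfolding e_def vf_deriv_def unfolding x_def by simp_all
  qed (use that eps in \<open>simp_all add: e_e e_\<xi> \<xi>_\<xi>\<close>)
  note W = smooth_on_bilinear[OF bounded_bilinear_wedge open_V smooth_\<xi> smooth_N]
  have lap: "laplacian x E (\<lambda>q. wedge (\<xi> q) (N q)) p = 0" if "p \<in> V" for p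
  proof -
    have d: "vf_deriv X (\<lambda>q. wedge (\<xi> q) (N q)) q = vf_deriv X (gauss_map A f \<circ> \<psi>) q" if "q \<in> V" for X q
      by (rule vf_deriv_cong[OF open_V that _ W]) (simp add: nu)
    have "vf_deriv (E i) (vf_deriv (E i) (\<lambda>q. wedge (\<xi> q) (N q))) p
      = vf_deriv (E i) (vf_deriv (E i) (gauss_map A f \<circ> \<psi>)) p" for i
      by (rule vf_deriv_cong[OF open_V that d smooth_on_vf_deriv[OF open_V smooth_E W]])
    then have "laplacian x E (\<lambda>q. wedge (\<xi> q) (N q)) p = laplacian x E (gauss_map A f \<circ> \<psi>) p"
      by (simp add: laplacian_def d[OF that])
    also have "\<dots> = 0"
      using harm chart V(1) E that unfolding harmonic_map_def x_def by blast
    finally show ?thesis .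
  qed
  show thesis
  proof (rule harmonic_null_hyperplane[OF V(3,4) lap])
    fix k assume "lorentz k k = 0" "k \<noteq> 0" "\<And>p. p \<in> V \<Longrightarrow> lorentz (x p) k = \<epsilon> / r"
    then show thesis using that[of k] by (simp add: x_def)
  qed
qed

text \<open>Once the null vectors are aligned, \<open>paraboloid_iff\<close> puts the moved patch
  inside the model surface. What remains is that it fills an open set of parameters, i.e. that its
  projection g to the middle coordinates is open.\<close>

lemma quadric_locally_congruent:
  assumes r: "r > 0" and eps: "\<epsilon> = 1 \<or> \<epsilon> = -1"
    and surf: "spacelike_surface M A f"
    and quadric: "\<And>q. q \<in> topspace M \<Longrightarrow> lorentz (f q) (f q) = \<epsilon> / r^2"
    and harm: "harmonic_map A f (gauss_map A f)"
  shows "locally_congruent M f (paraboloid \<epsilon> r)"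
  unfolding locally_congruent_def
proof
  fix q assume q: "q \<in> topspace M"
  have os: "oriented_surface M A" and im: "spacelike_immersion A f"
    using surf by (auto simp: spacelike_surface_def)
  have "topspace M = (\<Union>(U, \<psi>)\<in>A. \<psi> ` U)"
    using os by (simp add: oriented_surface_def)
  then obtain U \<psi> p0 where chart: "(U, \<psi>) \<in> A" "p0 \<in> U" "\<psi> p0 = q"
    using q by auto
  have U: "open U" "openin M (\<psi> ` U)" "embedding_map (top_of_set U) M \<psi>"
    using os chart unfolding oriented_surface_def by blast+
  have quadU: "lorentz (f (\<psi> p)) (f (\<psi> p)) = \<epsilon> / r^2" if "p \<in> U" for p
    using quadric openin_subset[OF U(2)] that by blast
  obtain d where d: "d > 0" "ball p0 d \<subseteq> U" using U(1) chart(2) open_contains_ball by blast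
  define V where "V = ball p0 d"
  have V: "V \<subseteq> U" "open V" "convex V" "V \<noteq> {}" "p0 \<in> V" using d by (auto simp: V_def)
  obtain k where k: "lorentz k k = 0" "k \<noteq> 0" "\<And>p. p \<in> V \<Longrightarrow> lorentz (f (\<psi> p)) k = \<epsilon> / r"
    using harmonic_patch[OF r eps surf chart(1) quadU harm V(1-4)] by blast
  \<comment> \<open>With this sign the condition <y, k0> = \<epsilon> / r reads y_1 - y_4 = 1 / r
    for either value of \<epsilon>.\<close>
  define k0 where "k0 = - \<epsilon> *\<^sub>R null_vector"
  have k0: "lorentz k0 k0 = 0" "k0 \<noteq> 0"
  proof -
    have "k0 $ 1 = - \<epsilon>" by (simp add: k0_def null_vector_def)
    then show "k0 \<noteq> 0" using eps by auto
  qed (simp add: k0_def lorentz_simps lorentz_null_vector)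
  obtain L where L: "linear_isometry L" "L k = k0"
    using null_vector_transitive[OF k(1,2) k0] .
  have linL: "linear L" and isoL: "\<And>x y. lorentz (L x) (L y) = lorentz x y"
    using L(1) by (auto simp: linear_isometry_def)
  define x where "x = f \<circ> \<psi>"
  have sx: "smooth_on x V" and reg: "\<And>p. p \<in> V \<Longrightarrow> inj (frechet_derivative x (at p)) \<and>
      (\<forall>w\<in>range (frechet_derivative x (at p)). w \<noteq> 0 \<longrightarrow> lorentz w w > 0)"
    using im chart V(1) unfolding spacelike_immersion_def Let_def x_def by (blast intro: smooth_on_subset)+
  define P where "P y = (vector [y $ 2, y $ 3] :: real^2)" for y :: "real^4"
  have linP: "linear P"
    by (rule linearI) (simp_all add: P_def vec_eq_iff forall_2)
  have linPL: "linear (\<lambda>y. P (L y))" using linear_compose[OF linL linP] by (simp add: o_def)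
  define g where "g p = P (L (x p))" for p
  have model: "L (x p) = paraboloid \<epsilon> r (g p)" if "p \<in> V" for p
  proof -
    have "lorentz (L (x p)) (L (x p)) = \<epsilon> / r^2"
      using quadU V(1) that by (auto simp: isoL x_def)
    moreover have "lorentz (L (x p)) (- \<epsilon> *\<^sub>R null_vector) = \<epsilon> / r"
      using k(3)[OF that] isoL[of "x p" k] by (simp add: L(2) k0_def x_def)
    ultimately show ?thesis
      using paraboloid_iff[OF r eps] by (simp add: g_def P_def)
  qed
  have "open (g ` V)"
  proof -
    have "g p \<in> interior (g ` V)" if p: "p \<in> V" for p
    proof -
      define dx where "dx = frechet_derivative x (at p)"
      have dx: "(x has_derivative dx) (at p)" unfolding dx_def by (rule smooth_on_has_derivative[OF sx p])
      then interpret dx: bounded_linear dx by (rule has_derivative_bounded_linear)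
      have dg: "(g has_derivative (\<lambda>v. P (L (dx v)))) (at p)"
        using bounded_linear.has_derivative[OF linPL[unfolded linear_conv_bounded_linear] dx]
        by (simp add: g_def[abs_def])
      have lin: "linear (\<lambda>v. P (L (dx v)))"
        using dg has_derivative_bounded_linear bounded_linear.linear by blast
      \<comment> \<open>The image of v is tangent to the degenerate hyperplane; with vanishing
        middle coordinates it is a multiple of the null vector. A space-like tangent plane contains
        no nonzero null vector.\<close>
      have "v = 0" if "P (L (dx v)) = 0" for v
      proof -
        have "((\<lambda>q. lorentz (x q) k) has_derivative (\<lambda>v. lorentz (dx v) k)) (at p)"
          using bounded_linear.has_derivative[OF bounded_bilinear.bounded_linear_left[OF bounded_bilinear_lorentz] dx] .
        moreover have "((\<lambda>q. lorentz (x q) k) has_derivative (\<lambda>v. 0)) (at p)"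
          by (rule has_derivative_transform_within_open[OF has_derivative_const V(2) p]) (simp add: k(3) x_def)
        ultimately have "(\<lambda>v. lorentz (dx v) k) = (\<lambda>v. 0)" by (rule has_derivative_unique)
        then have "lorentz (L (dx v)) k0 = 0" using isoL[of "dx v" k] by (simp add: L(2) fun_eq_iff)
        then have "L (dx v) $ 1 = L (dx v) $ 4"
          using eps by (auto simp: k0_def null_vector_def lorentz_def)
        moreover have "L (dx v) $ 2 = 0" "L (dx v) $ 3 = 0"
          using that by (simp_all add: P_def vec_eq_iff forall_2)
        ultimately have "lorentz (L (dx v)) (L (dx v)) = 0" by (simp add: lorentz_def)
        then have "lorentz (dx v) (dx v) = 0" by (simp add: isoL)
        then have "dx v = 0" using reg[OF p] unfolding dx_def by (metis less_irrefl rangeI)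
        then have "dx v = dx 0" by (simp add: dx.zero)
        then show "v = 0" using reg[OF p] unfolding dx_def by (simp only: inj_eq)
      qed
      then have "inj (\<lambda>v. P (L (dx v)))" using lin linear_injective_0 by blast
      then obtain g' where g': "linear g'" "g' \<circ> (\<lambda>v. P (L (dx v))) = id"
        using linear_injective_left_inverse[OF lin] by blast
      then have "(\<lambda>v. P (L (dx v))) \<circ> g' = id" using linear_inverse_left[OF lin g'(1)] by simp
      moreover have "continuous_on V g"
      proof -
        have "continuous_on V (\<lambda>p. P (L (x p)))"
          using linear_continuous_on_compose[OF smooth_on_continuous[OF sx] linPL] .
        then show ?thesis by (simp add: g_def)
      qed
      moreover have "bounded_linear g'" using g'(1) by (simp add: linear_conv_bounded_linear)
      moreover have "p \<in> interior V" using V(2) p by (simp add: interior_open)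
      ultimately show ?thesis
        using sussmann_open_mapping[OF V(2) _ p dg] by blast
    qed
    then have "interior (g ` V) = g ` V" using interior_subset by blast
    then show ?thesis using open_interior by metis
  qed
  moreover have "openin M (\<psi> ` V)"
  proof -
    have "homeomorphic_map (top_of_set U) (subtopology M (\<psi> ` U)) \<psi>"
      using U(3) by (simp add: embedding_map_def)
    moreover have "openin (top_of_set U) V" using V(1,2) by (simp add: open_subset)
    ultimately have "openin (subtopology M (\<psi> ` U)) (\<psi> ` V)"
      using homeomorphic_imp_open_map open_map_def by blast
    then show ?thesis using openin_trans_full U(2) by blast
  qed
  moreover have "q \<in> \<psi> ` V" using V(5) chart(3) by blast
  moreover have "L ` f ` \<psi> ` V = paraboloid \<epsilon> r ` g ` V"
    using model by (force simp: x_def image_image)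
  ultimately show "\<exists>N L W. openin M N \<and> q \<in> N \<and> linear_isometry L \<and> open W \<and> L ` f ` N = paraboloid \<epsilon> r ` W"
    using L(1) by blast
qed

text \<open>The parameters are the middle coordinates of the point itself, so
  \<open>paraboloid_iff\<close> applies.\<close>

lemma paraboloid_quadric:
  assumes "r > 0" "\<epsilon> = 1 \<or> \<epsilon> = -1"
  shows "lorentz (paraboloid \<epsilon> r p) (paraboloid \<epsilon> r p) = \<epsilon> / r^2"
proof -
  have "paraboloid \<epsilon> r p = paraboloid \<epsilon> r (vector [paraboloid \<epsilon> r p $ 2, paraboloid \<epsilon> r p $ 3])"
    by (simp add: paraboloid_def)
  then show ?thesis using paraboloid_iff[OF assms] by blast
qed

theorem corollary3p14:
  fixes r :: real
  assumes "r > 0"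
  shows
    "(spacelike_surface euclidean plane_atlas (surf_S31 r) \<and>
      range (surf_S31 r) \<subseteq> S31 (r^2) \<and>
      harmonic_map plane_atlas (surf_S31 r) (gauss_map plane_atlas (surf_S31 r)) \<and>
      (\<forall>(M :: 'a topology) A f.
         spacelike_surface M A f \<and> f ` topspace M \<subseteq> S31 (r^2) \<and>
         harmonic_map A f (gauss_map A f) \<longrightarrow> locally_congruent M f (surf_S31 r))) \<and>
     (spacelike_surface euclidean plane_atlas (surf_H3 r) \<and>
      range (surf_H3 r) \<subseteq> H3 (r^2) \<and>
      harmonic_map plane_atlas (surf_H3 r) (gauss_map plane_atlas (surf_H3 r)) \<and>
      (\<forall>(M :: 'a topology) A f.
         spacelike_surface M A f \<and> f ` topspace M \<subseteq> H3 (r^2) \<and>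
         harmonic_map A f (gauss_map A f) \<longrightarrow> locally_congruent M f (surf_H3 r)))"
proof -
  have S31: "range (paraboloid 1 r) \<subseteq> S31 (r^2)"
    using paraboloid_quadric[OF assms, of 1] by (auto simp: S31_def)
  have "paraboloid (-1) r p $ 1 > 0" for p
    using assms by (simp add: paraboloid_def add_pos_nonneg)
  then have H3: "range (paraboloid (-1) r) \<subseteq> H3 (r^2)"
    using paraboloid_quadric[OF assms, of "-1"] by (auto simp: H3_def)
  have unique_S31: "\<forall>(M :: 'a topology) A f. spacelike_surface M A f \<and> f ` topspace M \<subseteq> S31 (r^2) \<and>
      harmonic_map A f (gauss_map A f) \<longrightarrow> locally_congruent M f (paraboloid 1 r)"
  proof (intro allI impI, elim conjE)
    fix M :: "'a topology" and A f
    assume "spacelike_surface M A f" "f ` topspace M \<subseteq> S31 (r^2)" "harmonic_map A f (gauss_map A f)"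
    then show "locally_congruent M f (paraboloid 1 r)"
      by (intro quadric_locally_congruent[OF assms]) (auto simp: S31_def)
  qed
  have unique_H3: "\<forall>(M :: 'a topology) A f. spacelike_surface M A f \<and> f ` topspace M \<subseteq> H3 (r^2) \<and>
      harmonic_map A f (gauss_map A f) \<longrightarrow> locally_congruent M f (paraboloid (-1) r)"
  proof (intro allI impI, elim conjE)
    fix M :: "'a topology" and A f
    assume "spacelike_surface M A f" "f ` topspace M \<subseteq> H3 (r^2)" "harmonic_map A f (gauss_map A f)"
    then show "locally_congruent M f (paraboloid (-1) r)"
      by (intro quadric_locally_congruent[OF assms]) (auto simp: H3_def)
  qed
  show ?thesis
    unfolding paraboloid_surf
    by (intro conjI spacelike_paraboloid harmonic_paraboloid[OF assms] S31 H3 unique_S31 unique_H3) simp_all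
qed

end
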